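(* Let $n\geq 1$, let $\alpha\in\mathbb C$, and let $M$ be an $\mathfrak{sl}(2)$-module which is free of rank $n$ over $U(\mathfrak h)=\mathbb C[h]$ and which admits the central character $(2\alpha-1)^2$. Then there exist $K(h)\in \mathrm{GL}_n(\mathbb C[h])$ and a triple $\boldsymbol a=(a_-,a_0,a_+)\in\mathbb Z_{\geq0}\times\mathbb Z\times\mathbb Z_{\geq0}$ satisfying $a_-+|a_0|+a_+=n$ such that $$M\simeq M\Big(\sigma\big(K^{-1}(h)\,\overline P_{(\boldsymbol a,\alpha)}(h)\big),\;P_{(\boldsymbol a,\alpha)}(h)K(h)\Big).$$
   Context: The Lie algebra $\mathfrak{sl}(2)$ over $\mathbb C$ has basis $e,f,h$ with $[h,e]=e$, $[h,f]=-f$, $[e,f]=2h$ (so $h=\mathrm{diag}(\tfrac12,-\tfrac12)$), and $\mathfrak h=\mathbb Ch$. The element $c=(2h+1)^2+4fe$ is central in $U(\mathfrak{sl}(2))$; a module has central character $\gamma\in\mathbb C$ if $c$ acts on it by the scalar $\gamma$. The automorphism $\sigma$ of $\mathbb C[h]$ is $\sigma(g(h))=g(h-1)$, applied entrywise to vectors and matrices. For $E,F\in\mathrm{Mat}_n(\mathbb C[h])$ satisfying $E\sigma(F)-F\sigma^{-1}(E)=2h\,\mathrm I_n$, $M(E,F)$ denotes the $\mathfrak{sl}(2)$-module with underlying space $\mathbb C[h]^{\oplus n}$ (column vectors), on which $h$ acts by multiplication by $h$, $e\cdot\boldsymbol g=E\,\sigma(\boldsymbol g)$ and $f\cdot\boldsymbol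 g=F\,\sigma^{-1}(\boldsymbol g)$. For $\alpha\in\mathbb C$ put $\lambda_\alpha(h)=-(h-\alpha+1)(h+\alpha)$. For a triple $\boldsymbol a=(a_-,a_0,a_+)$ with $a_\pm\in\mathbb Z_{\geq0}$, $a_0\in\mathbb Z$, $a_-+|a_0|+a_+=n$, $P_{(\boldsymbol a,\alpha)}(h)\in\mathrm{Mat}_n(\mathbb C[h])$ is the diagonal matrix whose first $a_-$ diagonal entries are $1$, whose next $|a_0|$ diagonal entries are $h-\alpha+1$ if $a_0\geq0$ and $h+\alpha$ if $a_0<0$, and whose last $a_+$ diagonal entries are $(h-\alpha+1)(h+\alpha)$. $\overline P_{(\boldsymbol a,\alpha)}(h)$ is the diagonal matrix with $\overline P_{(\boldsymbol a,\alpha)}(h)P_{(\boldsymbol a,\alpha)}(h)=\lambda_\alpha(h)\mathrm I_n$. *)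

theory Defs
  imports "Jordan_Normal_Form.VS_Connect"
begin

subsection \<open>The Lie algebra sl(2) and its modules\<close>

definition sl2 :: "complex mat set" where
  "sl2 = {x \<in> carrier_mat 2 2. x $$ (0,0) + x $$ (1,1) = 0}"

definition sl2_e :: "complex mat" where
  "sl2_e = mat_of_rows_list 2 [[0, 1], [0, 0]]"

definition sl2_f :: "complex mat" where
  "sl2_f = mat_of_rows_list 2 [[0, 0], [1, 0]]"

definition sl2_h :: "complex mat" where
  "sl2_h = mat_of_rows_list 2 [[1/2, 0], [0, -1/2]]"

text \<open>The normalisation of h is half the usual one, so that the brackets are as follows.\<close>

lemma sl2_brackets:
  "sl2_h * sl2_e - sl2_e * sl2_h = sl2_e"
  "sl2_h * sl2_f - sl2_f * sl2_h = - sl2_f"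
  "sl2_e * sl2_f - sl2_f * sl2_e = 2 \<cdot>\<^sub>m sl2_h"
  by (rule eq_matI; auto simp: sl2_e_def sl2_f_def sl2_h_def mat_of_rows_list_def
        scalar_prod_def less_Suc_eq numeral_2_eq_2)+

text \<open>As usual for \<^typ>\<open>('a, 'b) module\<close>, the fields \<^const>\<open>monoid.mult\<close> and
  \<^const>\<open>monoid.one\<close> inherited from rings play no role.\<close>

record 'v sl2_rep = "(complex, 'v) module" +
  act :: "complex mat \<Rightarrow> 'v \<Rightarrow> 'v"

definition sl2_module :: "'v sl2_rep \<Rightarrow> bool" where
  "sl2_module M \<longleftrightarrow>
     Module.module class_ring M \<and>
     (\<forall>x\<in>sl2. act M x \<in> LinearCombinations.module_hom class_ring M M) \<and>
     (\<forall>x\<in>sl2. \<forall>y\<in>sl2. \<forall>v\<in>carrier M. act M (x + y) v = act M x v \<oplus>\<^bsub>M\<^esub> act M y v) \<and>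
     (\<forall>c. \<forall>x\<in>sl2. \<forall>v\<in>carrier M. act M (c \<cdot>\<^sub>m x) v = c \<odot>\<^bsub>M\<^esub> act M x v) \<and>
     (\<forall>x\<in>sl2. \<forall>y\<in>sl2. \<forall>v\<in>carrier M.
        act M (x * y - y * x) v = act M x (act M y v) \<ominus>\<^bsub>M\<^esub> act M y (act M x v))"

definition sl2_isomorphic :: "'v sl2_rep \<Rightarrow> 'w sl2_rep \<Rightarrow> bool" where
  "sl2_isomorphic M N \<longleftrightarrow>
     (\<exists>\<phi> \<in> LinearCombinations.module_hom (class_ring :: complex ring) M N.
        bij_betw \<phi> (carrier M) (carrier N) \<and>
        (\<forall>x\<in>sl2. \<forall>v\<in>carrier M. \<phi> (act M x v) = act N x (\<phi> v)))"

text \<open>The central element is c = (2h+1)^2 + 4fe.\<close>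

definition casimir :: "'v sl2_rep \<Rightarrow> 'v \<Rightarrow> 'v" where
  "casimir M v =
     (let t = (\<lambda>w. 2 \<odot>\<^bsub>M\<^esub> act M sl2_h w \<oplus>\<^bsub>M\<^esub> w)
      in t (t v) \<oplus>\<^bsub>M\<^esub> 4 \<odot>\<^bsub>M\<^esub> act M sl2_f (act M sl2_e v))"

definition has_central_character :: "'v sl2_rep \<Rightarrow> complex \<Rightarrow> bool" where
  "has_central_character M \<gamma> \<longleftrightarrow> (\<forall>v\<in>carrier M. casimir M v = \<gamma> \<odot>\<^bsub>M\<^esub> v)"


subsection \<open>Restriction to U(h) = C[h]\<close>

definition Uh_module :: "'v sl2_rep \<Rightarrow> (complex poly, 'v) module" where
  "Uh_module M =
     \<lparr>carrier = carrier M, mult = mult M, one = one M, zero = zero M, add = add M,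
      smult = (\<lambda>p v. \<Oplus>\<^bsub>M\<^esub>k\<in>{..degree p}. coeff p k \<odot>\<^bsub>M\<^esub> (act M sl2_h ^^ k) v)\<rparr>"

definition free_of_rank :: "('a, 'c) ring_scheme \<Rightarrow> ('a, 'b, 'd) module_scheme \<Rightarrow> nat \<Rightarrow> bool" where
  "free_of_rank R V n \<longleftrightarrow>
     (\<exists>B. B \<subseteq> carrier V \<and> finite B \<and> card B = n \<and>
        \<not> LinearCombinations.module.lin_dep R V B \<and> LinearCombinations.module.span R V B = carrier V)"


subsection \<open>The modules M(E, F)\<close>

text \<open>Elements g(h) of C[h] are complex polynomials, with h the polynomial variable.\<close>

definition \<sigma> :: "complex poly \<Rightarrow> complex poly" where
  "\<sigma> g = g \<circ>\<^sub>p [:-1, 1:]"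

definition \<sigma>_inv :: "complex poly \<Rightarrow> complex poly" where
  "\<sigma>_inv g = g \<circ>\<^sub>p [:1, 1:]"

lemma \<sigma>_inverse: "\<sigma> (\<sigma>_inv g) = g" "\<sigma>_inv (\<sigma> g) = g"
  by (simp_all add: \<sigma>_def \<sigma>_inv_def pcompose_assoc [symmetric] pcompose_pCons)

definition admissible :: "nat \<Rightarrow> complex poly mat \<Rightarrow> complex poly mat \<Rightarrow> bool" where
  "admissible n E F \<longleftrightarrow> E \<in> carrier_mat n n \<and> F \<in> carrier_mat n n \<and>
     E * map_mat \<sigma> F - F * map_mat \<sigma>_inv E = [:0, 2:] \<cdot>\<^sub>m 1\<^sub>m n"

text \<open>The traceless matrix x equals 2 x11 h + x12 e + x21 f.\<close>

definition M_EF :: "nat \<Rightarrow> complex poly mat \<Rightarrow> complex poly mat \<Rightarrow> complex poly vec sl2_rep" where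
  "M_EF n E F =
     \<lparr>carrier = carrier_vec n, mult = undefined, one = undefined, zero = 0\<^sub>v n, add = (+),
      smult = (\<lambda>c g. [:c:] \<cdot>\<^sub>v g),
      act = (\<lambda>x g. [:2 * x $$ (0,0):] \<cdot>\<^sub>v ([:0, 1:] \<cdot>\<^sub>v g)
                 + [:x $$ (0,1):] \<cdot>\<^sub>v (E *\<^sub>v map_vec \<sigma> g)
                 + [:x $$ (1,0):] \<cdot>\<^sub>v (F *\<^sub>v map_vec \<sigma>_inv g))\<rparr>"

lemma act_M_EF:
  assumes "E \<in> carrier_mat n n" "F \<in> carrier_mat n n" "g \<in> carrier_vec n"
  shows "act (M_EF n E F) sl2_h g = [:0, 1:] \<cdot>\<^sub>v g"
    and "act (M_EF n E F) sl2_e g = E *\<^sub>v map_vec \<sigma> g"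
    and "act (M_EF n E F) sl2_f g = F *\<^sub>v map_vec \<sigma>_inv g"
  using assms
  by (auto simp: M_EF_def sl2_h_def sl2_e_def sl2_f_def mat_of_rows_list_def intro!: eq_vecI)


subsection \<open>The diagonal matrices P and P-bar\<close>

text \<open>The triple is (am, a0, ap), and the size of the matrices is am + |a0| + ap.
  The linear polynomials are h - alpha + 1 and h + alpha.\<close>

definition lam :: "complex \<Rightarrow> complex poly" where
  "lam \<alpha> = - ([:1 - \<alpha>, 1:] * [:\<alpha>, 1:])"

definition P_diag :: "nat \<Rightarrow> int \<Rightarrow> nat \<Rightarrow> complex \<Rightarrow> complex poly list" where
  "P_diag am a0 ap \<alpha> =
     replicate am 1
     @ replicate (nat \<bar>a0\<bar>) (if a0 \<ge> 0 then [:1 - \<alpha>, 1:] else [:\<alpha>, 1:])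
     @ replicate ap ([:1 - \<alpha>, 1:] * [:\<alpha>, 1:])"

definition P_mat :: "nat \<Rightarrow> int \<Rightarrow> nat \<Rightarrow> complex \<Rightarrow> complex poly mat" where
  "P_mat am a0 ap \<alpha> = mat_diag (am + nat \<bar>a0\<bar> + ap) (\<lambda>i. P_diag am a0 ap \<alpha> ! i)"

text \<open>Each entry of P divides lam, so the division below is exact.\<close>

definition Pbar_mat :: "nat \<Rightarrow> int \<Rightarrow> nat \<Rightarrow> complex \<Rightarrow> complex poly mat" where
  "Pbar_mat am a0 ap \<alpha> = mat_diag (am + nat \<bar>a0\<bar> + ap) (\<lambda>i. lam \<alpha> div P_diag am a0 ap \<alpha> ! i)"

lemma P_diag_dvd_lam:
  assumes "i < am + nat \<bar>a0\<bar> + ap"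
  shows "P_diag am a0 ap \<alpha> ! i dvd lam \<alpha>" "P_diag am a0 ap \<alpha> ! i \<noteq> 0"
proof -
  let ?n = "am + nat \<bar>a0\<bar> + ap"
  have "P_diag am a0 ap \<alpha> ! i \<in> set (P_diag am a0 ap \<alpha>)"
    using assms by (intro nth_mem) (simp add: P_diag_def)
  then have mem: "P_diag am a0 ap \<alpha> ! i \<in> {1, [:1 - \<alpha>, 1:], [:\<alpha>, 1:], [:1 - \<alpha>, 1:] * [:\<alpha>, 1:]}"
    unfolding P_diag_def by (auto split: if_splits)
  have "p dvd lam \<alpha> \<and> p \<noteq> 0"
    if "p \<in> {1, [:1 - \<alpha>, 1:], [:\<alpha>, 1:], [:1 - \<alpha>, 1:] * [:\<alpha>, 1:]}" for p
    using that unfolding lam_def dvd_minus_iff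
    by (elim insertE emptyE) (simp_all only: one_dvd dvd_triv_left dvd_triv_right dvd_refl, simp_all)
  with mem show "P_diag am a0 ap \<alpha> ! i dvd lam \<alpha>" "P_diag am a0 ap \<alpha> ! i \<noteq> 0"
    by blast+
qed

lemma Pbar_mat_unique:
  fixes am ap :: nat and a0 :: int and \<alpha> :: complex
  defines "n \<equiv> am + nat \<bar>a0\<bar> + ap"
  shows "Q \<in> carrier_mat n n \<and> diagonal_mat Q \<and> Q * P_mat am a0 ap \<alpha> = lam \<alpha> \<cdot>\<^sub>m 1\<^sub>m n
           \<longleftrightarrow> Q = Pbar_mat am a0 ap \<alpha>"
proof -
  let ?p = "\<lambda>i. P_diag am a0 ap \<alpha> ! i"
  have entries: "(Q * P_mat am a0 ap \<alpha> = lam \<alpha> \<cdot>\<^sub>m 1\<^sub>m n) \<longleftrightarrow> (\<forall>i<n. Q $$ (i,i) * ?p i = lam \<alpha>)"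
    if "Q \<in> carrier_mat n n" "diagonal_mat Q" for Q
  proof -
    have prod: "Q * P_mat am a0 ap \<alpha> = Matrix.mat n n (\<lambda>(i,j). Q $$ (i,j) * ?p j)"
      unfolding P_mat_def n_def [symmetric] using that(1) by (rule mat_diag_mult_right)
    show ?thesis
      unfolding prod using that by (auto simp: mat_eq_iff diagonal_mat_def)
  qed
  have Pbar: "Pbar_mat am a0 ap \<alpha> \<in> carrier_mat n n" "diagonal_mat (Pbar_mat am a0 ap \<alpha>)"
    by (auto simp: Pbar_mat_def n_def diagonal_mat_def mat_diag_def)
  have Pbar_entries: "Pbar_mat am a0 ap \<alpha> $$ (i,i) = lam \<alpha> div ?p i" if "i < n" for i
    using that by (simp add: Pbar_mat_def n_def mat_diag_def)
  show ?thesis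
  proof
    assume "Q = Pbar_mat am a0 ap \<alpha>"
    then show "Q \<in> carrier_mat n n \<and> diagonal_mat Q \<and> Q * P_mat am a0 ap \<alpha> = lam \<alpha> \<cdot>\<^sub>m 1\<^sub>m n"
      using Pbar entries [OF Pbar] Pbar_entries P_diag_dvd_lam(1) by (simp add: n_def)
  next
    assume Q: "Q \<in> carrier_mat n n \<and> diagonal_mat Q \<and> Q * P_mat am a0 ap \<alpha> = lam \<alpha> \<cdot>\<^sub>m 1\<^sub>m n"
    then have "Q $$ (i,i) * ?p i = lam \<alpha>" if "i < n" for i
      using entries that by blast
    then have "Q $$ (i,i) = lam \<alpha> div ?p i" if "i < n" for i
      using that P_diag_dvd_lam(2) n_def by (metis nonzero_mult_div_cancel_right)
    then have "Q $$ (i,j) = Pbar_mat am a0 ap \<alpha> $$ (i,j)" if "i < n" "j < n" for i j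
      using that Q Pbar Pbar_entries by (cases "i = j") (auto simp: diagonal_mat_def)
    then show "Q = Pbar_mat am a0 ap \<alpha>"
      using Q Pbar(1) by (intro eq_matI) auto
  qed
qed

end

theory Submission
  imports Defs
begin

text \<open>In a basis of M over C[h], the operators e and f are semilinear and given by matrices E and F. The
  central character says that fe acts as \<^term>\<open>lam \<alpha>\<close>, i.e. F times \<open>\<sigma>_inv E\<close> is a scalar matrix
  whose entry is a product of two linear factors. Hence the invariant factors of F divide this product; since
  they form a divisibility chain, they are exactly the diagonal of some P up to units. Writing F = U P V and
  changing the basis by U turns F into \<open>P K\<close> with \<open>K = V \<sigma>_inv(U)\<close>, and E is then determined by F because
  f acts injectively.\<close>

subsection \<open>Equivalence of matrices and the Smith normal form\<close>

text \<open>Passing to the basis formed by the columns of U replaces F by U^{-1} F \<sigma>_inv(U),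
  because f is only semilinear over C[h]. This twisted conjugation offers one free matrix, whereas
  the Smith normal form spends two independent ones. So the left factor can be removed, but the
  right one cannot, and it survives as the invertible matrix K. A single signed integer
  \<open>a0\<close> can describe the middle block because the two linear polynomials are both
  present in a divisibility chain only if they coincide, that is, for \<alpha> = 1/2; its sign then
  merely selects between two names of the same polynomial.\<close>

abbreviation GL :: "nat \<Rightarrow> 'a :: comm_ring_1 mat set" where
  "GL n \<equiv> Units (ring_mat TYPE('a) n ())"

lemma GL_iff:
  "U \<in> GL n \<longleftrightarrow> U \<in> carrier_mat n n \<and> (\<exists>V\<in>carrier_mat n n. V * U = 1\<^sub>m n \<and> U * V = 1\<^sub>m n)"
  by (auto simp: Units_def ring_mat_simps)

lemma GL_carrier: "U \<in> GL n \<Longrightarrow> U \<in> carrier_mat n n"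
  by (simp add: GL_iff)

lemma GL_inv:
  assumes "U \<in> GL n"
  shows "inv\<^bsub>ring_mat TYPE('a :: comm_ring_1) n ()\<^esub> U \<in> GL n"
    "U * inv\<^bsub>ring_mat TYPE('a) n ()\<^esub> U = 1\<^sub>m n"
    "inv\<^bsub>ring_mat TYPE('a) n ()\<^esub> U * U = 1\<^sub>m n"
proof -
  interpret ring "ring_mat TYPE('a) n ()" by (rule ring_mat)
  show "inv\<^bsub>ring_mat TYPE('a) n ()\<^esub> U \<in> GL n"
    "U * inv\<^bsub>ring_mat TYPE('a) n ()\<^esub> U = 1\<^sub>m n"
    "inv\<^bsub>ring_mat TYPE('a) n ()\<^esub> U * U = 1\<^sub>m n"
    using Units_r_inv[OF assms] Units_l_inv[OF assms] assms by (auto simp: ring_mat_simps)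
qed

lemma GL_one: "1\<^sub>m n \<in> GL n"
  by (auto simp: GL_iff)

lemma GL_mult:
  fixes U V :: "'a :: comm_ring_1 mat"
  assumes "U \<in> GL n" "V \<in> GL n" shows "U * V \<in> GL n"
proof -
  interpret ring "ring_mat TYPE('a) n ()" by (rule ring_mat)
  show ?thesis using Units_m_closed[OF assms] by (simp add: ring_mat_simps)
qed

definition mat_equiv :: "nat \<Rightarrow> 'a :: comm_ring_1 mat \<Rightarrow> 'a mat \<Rightarrow> bool" where
  "mat_equiv n A B \<longleftrightarrow> (\<exists>U\<in>GL n. \<exists>V\<in>GL n. B = U * A * V)"

lemma mat_equiv_carrier: "mat_equiv n A B \<Longrightarrow> A \<in> carrier_mat n n \<Longrightarrow> B \<in> carrier_mat n n"
  by (auto simp: mat_equiv_def dest!: GL_carrier)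

lemma mat_equiv_left: "A \<in> carrier_mat n n \<Longrightarrow> U \<in> GL n \<Longrightarrow> mat_equiv n A (U * A)"
  unfolding mat_equiv_def
  by (rule bexI[of _ U], rule bexI[of _ "1\<^sub>m n"]) (auto simp: GL_one dest!: GL_carrier)

lemma mat_equiv_right: "A \<in> carrier_mat n n \<Longrightarrow> V \<in> GL n \<Longrightarrow> mat_equiv n A (A * V)"
  unfolding mat_equiv_def
  by (rule bexI[of _ "1\<^sub>m n"], rule bexI[of _ V]) (auto simp: GL_one dest!: GL_carrier)

lemma mat_equiv_refl: "A \<in> carrier_mat n n \<Longrightarrow> mat_equiv n A A"
  using mat_equiv_left[of A n "1\<^sub>m n"] by (simp add: GL_one)

lemma mat_equiv_trans:
  assumes "A \<in> carrier_mat n n" "mat_equiv n A B" "mat_equiv n B C"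
  shows "mat_equiv n A C"
proof -
  obtain U V U' V' where *: "U \<in> GL n" "V \<in> GL n" "U' \<in> GL n" "V' \<in> GL n"
    and B: "B = U * A * V" and C: "C = U' * B * V'"
    using assms(2,3) by (auto simp: mat_equiv_def)
  note car = *[THEN GL_carrier] assms(1)
  have "C = U' * (U * A * V) * V'" by (simp add: B C)
  also have "\<dots> = U' * (U * A * V * V')"
    using car by (intro assoc_mult_mat) auto
  also have "U * A * V * V' = U * A * (V * V')"
    using car by (intro assoc_mult_mat) auto
  also have "U' * (U * A * (V * V')) = U' * (U * A) * (V * V')"
    using car by (intro assoc_mult_mat[symmetric]) auto
  also have "U' * (U * A) = U' * U * A"
    using car by (intro assoc_mult_mat[symmetric]) auto
  finally show ?thesis
    unfolding mat_equiv_def using *[THEN GL_mult] GL_mult * by blast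
qed

lemma mat_equiv_sym:
  fixes A :: "'a :: comm_ring_1 mat"
  assumes "A \<in> carrier_mat n n" "mat_equiv n A B"
  shows "mat_equiv n B A"
proof -
  obtain U V where *: "U \<in> GL n" "V \<in> GL n" and B: "B = U * A * V"
    using assms(2) by (auto simp: mat_equiv_def)
  let ?U = "inv\<^bsub>ring_mat TYPE('a) n ()\<^esub> U" and ?V = "inv\<^bsub>ring_mat TYPE('a) n ()\<^esub> V"
  note inv = *[THEN GL_inv(1)]
  note car = *[THEN GL_carrier] inv[THEN GL_carrier] assms(1)
  have "?U * B * ?V = ?U * (U * A * V * ?V)"
    unfolding B using car by (intro assoc_mult_mat) auto
  also have "U * A * V * ?V = U * A * (V * ?V)"
    using car by (intro assoc_mult_mat) auto
  also have "\<dots> = U * A" using car *(2) by (simp add: GL_inv)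
  also have "?U * (U * A) = ?U * U * A"
    using car by (intro assoc_mult_mat[symmetric]) auto
  also have "\<dots> = A" using car *(1) by (simp add: GL_inv)
  finally show ?thesis unfolding mat_equiv_def using inv by metis
qed

section \<open>Elementary operations as equivalences\<close>

lemma mat_equiv_addrow:
  assumes "A \<in> carrier_mat n n" "k < n" "l < n" "k \<noteq> l"
  shows "mat_equiv n A (addrow a k l A)"
  using assms by (simp add: addrow_mat[OF assms(1,3)] mat_equiv_left addrow_mat_Unit)

lemma mat_equiv_addcol:
  assumes "A \<in> carrier_mat n n" "k < n" "l < n" "k \<noteq> l"
  shows "mat_equiv n A (addcol a k l A)"
  using assms by (subst addcol_mat[of _ n n]) (auto intro!: mat_equiv_right addrow_mat_Unit)

lemma mat_equiv_swaprows:
  assumes "A \<in> carrier_mat n n" "k < n" "l < n"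
  shows "mat_equiv n A (swaprows k l A)"
  using assms by (simp add: swaprows_mat[OF assms] mat_equiv_left swaprows_mat_Unit)

lemma mat_equiv_swapcols:
  assumes "A \<in> carrier_mat n n" "k < n" "l < n"
  shows "mat_equiv n A (swapcols k l A)"
  using assms by (simp add: swapcols_mat[OF assms] mat_equiv_right swaprows_mat_Unit)

text \<open>Entries of U A V are linear combinations of entries of A. In the Smith induction this
  carries divisibility by the pivot from the remaining block to its diagonal form.\<close>

lemma mat_equiv_dvd:
  fixes A :: "'a :: comm_ring_1 mat"
  assumes "mat_equiv n A B" "A \<in> carrier_mat n n"
    and dvd: "\<And>i j. i < n \<Longrightarrow> j < n \<Longrightarrow> p dvd A $$ (i,j)"
    and "i < n" "j < n"
  shows "p dvd B $$ (i,j)"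
proof -
  obtain U V where *: "U \<in> GL n" "V \<in> GL n" and B: "B = U * A * V"
    using assms(1) by (auto simp: mat_equiv_def)
  note car = *[THEN GL_carrier] assms(2)
  define W where "W = U * A"
  have "p dvd W $$ (i, k)" if "k < n" for k
    using car that assms(4) by (auto simp: W_def scalar_prod_def intro!: dvd_sum dvd_mult dvd)
  moreover have "W \<in> carrier_mat n n" using car by (auto simp: W_def)
  ultimately show ?thesis
    unfolding B W_def[symmetric] using car assms(4,5)
    by (auto simp: scalar_prod_def intro!: dvd_sum dvd_mult2)
qed

section \<open>Bordered matrices diag(p, A) and one step of elimination\<close>

definition cons_mat :: "nat \<Rightarrow> 'a :: zero \<Rightarrow> 'a mat \<Rightarrow> 'a mat" where
  "cons_mat n p A = four_block_mat (mat 1 1 (\<lambda>_. p)) (0\<^sub>m 1 n) (0\<^sub>m n 1) A"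

lemma cons_mat_carrier: "A \<in> carrier_mat n n \<Longrightarrow> cons_mat n p A \<in> carrier_mat (Suc n) (Suc n)"
  by (auto simp: cons_mat_def)

lemma cons_mat_mult:
  assumes "A \<in> carrier_mat n n" "B \<in> carrier_mat n n"
  shows "cons_mat n p A * cons_mat n (q :: 'a :: comm_ring_1) B = cons_mat n (p * q) (A * B)"
proof -
  have "mat 1 1 (\<lambda>_. p) * mat 1 1 (\<lambda>_. q) = mat 1 1 (\<lambda>_. p * q)"
    by (rule eq_matI) (auto simp: scalar_prod_def)
  then show ?thesis
    unfolding cons_mat_def using assms by (subst mult_four_block_mat[of _ 1 1 _ n _ n]) auto
qed

lemma cons_mat_one: "cons_mat n 1 (1\<^sub>m n) = 1\<^sub>m (Suc n)"
  by (rule eq_matI) (auto simp: cons_mat_def)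

lemma cons_mat_diag: "cons_mat n p (mat_diag n d) = mat_diag (Suc n) (case_nat p d)"
  by (rule eq_matI) (auto simp: cons_mat_def mat_diag_def split: nat.split)

lemma cons_mat_index:
  assumes "A \<in> carrier_mat n n"
  shows "cons_mat n p A $$ (0,0) = p"
    "i < n \<Longrightarrow> j < n \<Longrightarrow> cons_mat n p A $$ (Suc i, Suc j) = A $$ (i,j)"
    "j < n \<Longrightarrow> cons_mat n p A $$ (0, Suc j) = 0"
    "i < n \<Longrightarrow> cons_mat n p A $$ (Suc i, 0) = 0"
  using assms by (auto simp: cons_mat_def)

lemma cons_mat_GL:
  fixes U :: "'a :: comm_ring_1 mat"
  assumes "U \<in> GL n" shows "cons_mat n 1 U \<in> GL (Suc n)"
proof -
  obtain V where V: "V \<in> carrier_mat n n" "V * U = 1\<^sub>m n" "U * V = 1\<^sub>m n"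
    using assms by (auto simp: GL_iff)
  have U: "U \<in> carrier_mat n n" using assms by (rule GL_carrier)
  show ?thesis
    unfolding GL_iff using U V
    by (intro conjI bexI[of _ "cons_mat n 1 V"]) (auto simp: cons_mat_mult cons_mat_one cons_mat_carrier)
qed

lemma mat_equiv_cons_mat:
  assumes "mat_equiv n A B" "A \<in> carrier_mat n n"
  shows "mat_equiv (Suc n) (cons_mat n p A) (cons_mat n p B)"
proof -
  obtain U V where *: "U \<in> GL n" "V \<in> GL n" and B: "B = U * A * V"
    using assms(1) by (auto simp: mat_equiv_def)
  note car = *[THEN GL_carrier] assms(2)
  have "cons_mat n p B = cons_mat n 1 U * cons_mat n p A * cons_mat n 1 V"
    using car by (simp add: cons_mat_mult B)
  with *[THEN cons_mat_GL] show ?thesis unfolding mat_equiv_def by blast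
qed

text \<open>One step of block Gaussian elimination: since the corner divides the rest of its row and
  column, unipotent block matrices on the left and on the right clear both at once.\<close>

lemma mat_equiv_clear_cross:
  fixes A :: "'a :: comm_ring_1 mat"
  assumes A: "A \<in> carrier_mat (Suc n) (Suc n)"
    and row: "\<And>j. j < n \<Longrightarrow> A $$ (0,0) dvd A $$ (0, Suc j)"
    and col: "\<And>i. i < n \<Longrightarrow> A $$ (0,0) dvd A $$ (Suc i, 0)"
  obtains D where "D \<in> carrier_mat n n" "mat_equiv (Suc n) A (cons_mat n (A $$ (0,0)) D)"
proof -
  define p where "p = A $$ (0,0)"
  obtain r where r: "\<And>j. j < n \<Longrightarrow> A $$ (0, Suc j) = p * r j"
    using row unfolding dvd_def p_def by metis
  obtain c where c: "\<And>i. i < n \<Longrightarrow> A $$ (Suc i, 0) = p * c i"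
    using col unfolding dvd_def p_def by metis
  \<comment> \<open>The Schur complement of the corner p. With the column written as p c_i and the
    row as p r_j, its correction term is c_i p r_j, so no inverse of p occurs.\<close>
  define D where "D = mat n n (\<lambda>(i,j). A $$ (Suc i, Suc j) - c i * p * r j)"
  \<comment> \<open>The parameter s makes \<open>L\<close> and \<open>R\<close> one-parameter
    families whose members at s and -s are mutually inverse; elimination uses s = -1.\<close>
  define L :: "'a \<Rightarrow> 'a mat" where
    "L s = four_block_mat (1\<^sub>m 1) (0\<^sub>m 1 n) (mat n 1 (\<lambda>(i,_). s * c i)) (1\<^sub>m n)" for s
  define R :: "'a \<Rightarrow> 'a mat" where
    "R s = four_block_mat (1\<^sub>m 1) (mat 1 n (\<lambda>(_,j). s * r j)) (0\<^sub>m n 1) (1\<^sub>m n)" for s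
  have L_carrier: "L s \<in> carrier_mat (Suc n) (Suc n)"
    and R_carrier: "R s \<in> carrier_mat (Suc n) (Suc n)" for s
    by (auto simp: L_def R_def)
  have A_block: "A = four_block_mat (mat 1 1 (\<lambda>_. p)) (mat 1 n (\<lambda>(_,j). p * r j))
      (mat n 1 (\<lambda>(i,_). p * c i)) (mat n n (\<lambda>(i,j). A $$ (Suc i, Suc j)))"
    using A r c by (intro eq_matI) (auto simp: p_def gr0_conv_Suc)
  have one: "four_block_mat (1\<^sub>m 1) (0\<^sub>m 1 n) (0\<^sub>m n 1) (1\<^sub>m n) = (1\<^sub>m (Suc n) :: 'a mat)"
    by (rule eq_matI) auto
  have LL: "L s * L t = 1\<^sub>m (Suc n)" if "s + t = 0" for s t
  proof -
    have "mat n 1 (\<lambda>(i,_). s * c i) + mat n 1 (\<lambda>(i,_). t * c i) = 0\<^sub>m n 1"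
      using that by (intro eq_matI) (auto simp flip: distrib_right)
    then show ?thesis unfolding L_def
      by (subst mult_four_block_mat[of _ 1 1 _ n _ n]) (auto simp: one)
  qed
  have RR: "R s * R t = 1\<^sub>m (Suc n)" if "s + t = 0" for s t
  proof -
    have "mat 1 n (\<lambda>(_,j). t * r j) + mat 1 n (\<lambda>(_,j). s * r j) = 0\<^sub>m 1 n"
      using that by (intro eq_matI) (auto simp: add.commute simp flip: distrib_right)
    then show ?thesis unfolding R_def
      by (subst mult_four_block_mat[of _ 1 1 _ n _ n]) (auto simp: one)
  qed
  have GL: "L (-1) \<in> GL (Suc n)" "R (-1) \<in> GL (Suc n)"
    unfolding GL_iff
    using LL[of 1 "-1"] LL[of "-1" 1] RR[of 1 "-1"] RR[of "-1" 1] L_carrier R_carrier by auto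
  have "L (-1) * A * R (-1) = cons_mat n p D"
    unfolding L_def R_def cons_mat_def D_def
    apply (subst A_block)
    apply (subst mult_four_block_mat[of _ 1 1 _ n _ n], auto)
    apply (subst mult_four_block_mat[of _ 1 1 _ n _ n], auto)
    apply (rule cong_four_block_mat)
    by (rule eq_matI; auto simp: scalar_prod_def algebra_simps)+
  moreover have "D \<in> carrier_mat n n" by (simp add: D_def)
  ultimately show ?thesis
    using that GL unfolding mat_equiv_def p_def by metis
qed

text \<open>The pivot p is an entry of minimal Euclidean size among all entries of all matrices equivalent to A;
  this minimality alone forces p to divide its row and column, and then the remaining block.\<close>

lemma smith_normal_form:
  fixes A :: "'a :: euclidean_ring mat"
  assumes "A \<in> carrier_mat n n"
  shows "\<exists>d. mat_equiv n A (mat_diag n d) \<and> (\<forall>i j. i \<le> j \<longrightarrow> j < n \<longrightarrow> d i dvd d j)"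
  using assms
proof (induction n arbitrary: A)
  case 0
  then have "mat_diag 0 (\<lambda>_. 0) = A" by (intro eq_matI) (auto simp: mat_diag_def)
  with mat_equiv_refl[OF 0] show ?case by (intro exI[of _ "\<lambda>_. 0"]) auto
next
  case (Suc n)
  let ?N = "Suc n"
  note A = \<open>A \<in> carrier_mat ?N ?N\<close>
  show ?case
  proof (cases "A = 0\<^sub>m ?N ?N")
    case True
    have "mat_diag ?N (\<lambda>_. 0) = A" by (rule eq_matI) (auto simp: True mat_diag_def)
    with mat_equiv_refl[OF A] show ?thesis by (intro exI[of _ "\<lambda>_. 0"]) auto
  next
    case False
    define S where "S x \<longleftrightarrow> (case x of (B,i,j) \<Rightarrow> mat_equiv ?N A B \<and> i < ?N \<and> j < ?N \<and> B $$ (i,j) \<noteq> 0)" for x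
    define sz where "sz x = (case x of (B,i,j) \<Rightarrow> euclidean_size (B $$ (i,j)))" for x :: "'a mat \<times> nat \<times> nat"
    have "\<exists>x. S x"
    proof -
      obtain i j where "i < ?N" "j < ?N" "A $$ (i,j) \<noteq> 0"
        using False A by (auto simp: mat_eq_iff)
      then have "S (A,i,j)" using mat_equiv_refl[OF A] by (simp add: S_def)
      then show ?thesis ..
    qed
    then obtain x where x: "S x" "\<And>y. S y \<Longrightarrow> sz x \<le> sz y"
      using ex_has_least_nat[of S _ sz] by blast
    obtain B k l where xB: "x = (B,k,l)" by (cases x)
    define p where "p = B $$ (k,l)"
    have B: "mat_equiv ?N A B" "k < ?N" "l < ?N" "p \<noteq> 0"
      using x(1) by (auto simp: xB S_def p_def)
    have minimal: "euclidean_size p \<le> euclidean_size (C $$ (i,j))"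
      if "mat_equiv ?N A C" "i < ?N" "j < ?N" "C $$ (i,j) \<noteq> 0" for C i j
      using x(2)[of "(C,i,j)"] that by (simp add: S_def sz_def xB p_def)
    have dvd_row: "p dvd C $$ (0, Suc j)"
      if C: "mat_equiv ?N A C" "C $$ (0,0) = p" and j: "j < n" for C j
    proof (rule ccontr)
      assume "\<not> p dvd C $$ (0, Suc j)"
      then have neq: "C $$ (0, Suc j) mod p \<noteq> 0" by (simp add: dvd_eq_mod_eq_0)
      have Cc: "C \<in> carrier_mat ?N ?N" using C(1) A by (rule mat_equiv_carrier)
      \<comment> \<open>Subtracting a multiple of the pivot column leaves the remainder modulo p in
        this place. It is nonzero but smaller than p, against minimality.\<close>
      let ?C = "addcol (- (C $$ (0, Suc j) div p)) (Suc j) 0 C"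
      have "mat_equiv ?N A ?C"
        using mat_equiv_trans[OF A C(1) mat_equiv_addcol[OF Cc]] j by simp
      moreover have "?C $$ (0, Suc j) = C $$ (0, Suc j) mod p"
        using Cc j C(2) by (simp add: minus_mult_div_eq_mod [symmetric] mult.commute)
      ultimately have "euclidean_size p \<le> euclidean_size (C $$ (0, Suc j) mod p)"
        using minimal[of ?C 0 "Suc j"] j neq by simp
      with mod_size_less[OF B(4)] show False by (simp add: not_le [symmetric])
    qed
    have dvd_col: "p dvd C $$ (Suc i, 0)"
      if C: "mat_equiv ?N A C" "C $$ (0,0) = p" and i: "i < n" for C i
    proof (rule ccontr)
      assume "\<not> p dvd C $$ (Suc i, 0)"
      then have neq: "C $$ (Suc i, 0) mod p \<noteq> 0" by (simp add: dvd_eq_mod_eq_0)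
      have Cc: "C \<in> carrier_mat ?N ?N" using C(1) A by (rule mat_equiv_carrier)
      let ?C = "addrow (- (C $$ (Suc i, 0) div p)) (Suc i) 0 C"
      have "mat_equiv ?N A ?C"
        using mat_equiv_trans[OF A C(1) mat_equiv_addrow[OF Cc]] i by simp
      moreover have "?C $$ (Suc i, 0) = C $$ (Suc i, 0) mod p"
        using Cc i C(2) by (simp add: minus_mult_div_eq_mod [symmetric] mult.commute)
      ultimately have "euclidean_size p \<le> euclidean_size (C $$ (Suc i, 0) mod p)"
        using minimal[of ?C "Suc i" 0] i neq by simp
      with mod_size_less[OF B(4)] show False by (simp add: not_le [symmetric])
    qed
    \<comment> \<open>The swaps bring the pivot to the corner. They stay inside the equivalence
      class of A, over which p is minimal, so \<open>dvd_row\<close> and \<open>dvd_col\<close>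
      apply.\<close>
    let ?C = "swapcols 0 l (swaprows 0 k B)"
    have Bc: "B \<in> carrier_mat ?N ?N" using B(1) A by (rule mat_equiv_carrier)
    have C: "mat_equiv ?N A ?C"
      using B Bc by (intro mat_equiv_trans[OF A mat_equiv_trans[OF A B(1) mat_equiv_swaprows] mat_equiv_swapcols]) auto
    have C00: "?C $$ (0,0) = p" using B Bc by (simp add: p_def)
    have Cc: "?C \<in> carrier_mat ?N ?N" using C A by (rule mat_equiv_carrier)
    obtain D where D: "D \<in> carrier_mat n n" "mat_equiv ?N ?C (cons_mat n p D)"
      using mat_equiv_clear_cross[OF Cc] dvd_row[OF C C00] dvd_col[OF C C00] C00 by metis
    let ?D = "cons_mat n p D"
    have AD: "mat_equiv ?N A ?D" using mat_equiv_trans[OF A C D(2)] .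
    have Dc: "?D \<in> carrier_mat ?N ?N" using D(1) by (rule cons_mat_carrier)
    have dvd: "p dvd D $$ (i,j)" if ij: "i < n" "j < n" for i j
    proof -
      \<comment> \<open>Adding row \<open>Suc i\<close> to the top row keeps the corner p, because
        the column below it is zero, and copies the entries of D into the top row, where
        \<open>dvd_row\<close> reaches them.\<close>
      let ?E = "addrow 1 0 (Suc i) ?D"
      have "mat_equiv ?N A ?E"
        using mat_equiv_trans[OF A AD mat_equiv_addrow[OF Dc]] ij by simp
      moreover have "?E $$ (0,0) = p" "?E $$ (0, Suc j) = D $$ (i,j)"
        using Dc ij D(1) by (simp_all add: cons_mat_index)
      ultimately show ?thesis using dvd_row[of ?E j] ij by simp
    qed
    obtain d where d: "mat_equiv n D (mat_diag n d)" "\<And>i j. i \<le> j \<Longrightarrow> j < n \<Longrightarrow> d i dvd d j"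
      using Suc.IH[OF D(1)] by blast
    have pd: "p dvd d i" if "i < n" for i
      using mat_equiv_dvd[OF d(1) D(1) dvd, of i i] that by (simp add: mat_diag_def)
    have "mat_equiv ?N A (mat_diag ?N (case_nat p d))"
      using mat_equiv_trans[OF A AD mat_equiv_cons_mat[OF d(1) D(1)]] by (simp add: cons_mat_diag)
    moreover have "case_nat p d i dvd case_nat p d j" if "i \<le> j" "j < ?N" for i j
      using that d(2) pd by (auto split: nat.split)
    ultimately show ?thesis by blast
  qed
qed

subsection \<open>Matrices dividing a product of two linear polynomials\<close>

lemma divisors_linear:
  fixes d :: "'a :: field poly"
  assumes "d dvd [:b, 1:]"
  shows "\<exists>c. c \<noteq> 0 \<and> (d = [:c:] \<or> d = [:c:] * [:b, 1:])"
proof -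
  obtain e where e: "[:b, 1:] = d * e" using assms by (auto simp: dvd_def)
  then have "d \<noteq> 0" "e \<noteq> 0" by auto
  then have deg: "degree d + degree e = 1"
    using arg_cong[OF e, of degree] by (simp add: degree_mult_eq)
  show ?thesis
  proof (cases "degree d = 0")
    case True
    then obtain c where "d = [:c:]" by (rule degree_eq_zeroE)
    with \<open>d \<noteq> 0\<close> show ?thesis by auto
  next
    case False
    with deg have "degree e = 0" by simp
    then obtain c where c: "e = [:c:]" by (rule degree_eq_zeroE)
    with \<open>e \<noteq> 0\<close> have "c \<noteq> 0" by auto
    moreover have "d = [:1/c:] * [:b, 1:]"
      unfolding e c using \<open>c \<noteq> 0\<close> by simp
    ultimately show ?thesis by (intro exI[of _ "1/c"]) auto
  qed
qed

text \<open>If the first factor divides d, it cancels; otherwise its root is a root of the cofactor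
  of d, and it cancels there. Both cases leave a divisor of the second factor, and the argument
  covers a = b as well.\<close>

lemma divisors_linear_mult_linear:
  fixes d :: "'a :: field poly"
  assumes "d dvd [:a, 1:] * [:b, 1:]"
  shows "\<exists>c x. c \<noteq> 0 \<and> d = [:c:] * x \<and> x \<in> {1, [:a, 1:], [:b, 1:], [:a, 1:] * [:b, 1:]}"
proof (cases "[:a, 1:] dvd d")
  case True
  then obtain d' where d': "d = [:a, 1:] * d'" by (auto simp: dvd_def)
  then have "d' dvd [:b, 1:]" using assms
    by (metis dvd_mult_cancel_left pCons_eq_0_iff zero_neq_one)
  then obtain c where c: "c \<noteq> 0" "d' = [:c:] \<or> d' = [:c:] * [:b, 1:]"
    using divisors_linear by blast
  then have "d = [:c:] * [:a, 1:] \<or> d = [:c:] * ([:a, 1:] * [:b, 1:])"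
    using d' by (metis mult.commute mult.left_commute)
  with c(1) show ?thesis by blast
next
  case False
  obtain e where e: "[:a, 1:] * [:b, 1:] = d * e" using assms by (auto simp: dvd_def)
  have "poly d (-a) * poly e (-a) = 0"
    using arg_cong[OF e, of "\<lambda>p. poly p (-a)"] by simp
  moreover have "poly d (-a) \<noteq> 0" using False poly_eq_0_iff_dvd[of d "-a"] by simp
  ultimately have "[:a, 1:] dvd e" using poly_eq_0_iff_dvd[of e "-a"] by simp
  then obtain e' where "e = [:a, 1:] * e'" by (auto simp: dvd_def)
  with e have "[:a, 1:] * [:b, 1:] = [:a, 1:] * (d * e')" by (simp only: mult_ac)
  then have "d dvd [:b, 1:]"
    by (metis dvd_triv_left mult_left_cancel pCons_eq_0_iff zero_neq_one)
  then obtain c where c: "c \<noteq> 0" "d = [:c:] \<or> d = [:c:] * [:b, 1:]"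
    using divisors_linear by blast
  then have "d = [:c:] * 1 \<or> d = [:c:] * [:b, 1:]" by (simp only: mult_1_right)
  with c(1) show ?thesis by blast
qed

text \<open>Induction from the front: a new head divides everything behind it, which excludes most
  combinations with the blocks already present.\<close>

lemma dvd_chain_eq_P_diag:
  assumes "sorted_wrt (dvd) ds"
    and "set ds \<subseteq> {1, [:1 - \<alpha>, 1:], [:\<alpha>, 1:], [:1 - \<alpha>, 1:] * [:\<alpha>, 1:]}"
  shows "\<exists>am a0 ap. ds = P_diag am a0 ap \<alpha>"
  using assms
proof (induction ds)
  case Nil
  show ?case by (rule exI[of _ 0], rule exI[of _ 0], rule exI[of _ 0]) (simp add: P_diag_def)
next
  case (Cons d ds)
  let ?p = "[:1 - \<alpha>, 1:]" and ?q = "[:\<alpha>, 1:]"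
  have lin: "a = b" if "[:a, 1:] dvd [:b, 1 :: complex:]" for a b
    using that poly_eq_0_iff_dvd[of "[:b, 1:]" "-a"] by simp
  have unit: "\<not> [:a, 1:] dvd (1 :: complex poly)" for a by (simp add: is_unit_pCons_iff)
  obtain am a0 ap where ds: "ds = P_diag am a0 ap \<alpha>" using Cons by auto
  have dvd: "d dvd x" if "x \<in> set ds" for x using Cons.prems that by simp
  have set_ds: "am \<noteq> 0 \<Longrightarrow> 1 \<in> set ds"
    "a0 > 0 \<Longrightarrow> ?p \<in> set ds" "a0 < 0 \<Longrightarrow> ?q \<in> set ds"
    by (auto simp: ds P_diag_def)
  have "d \<in> {1, ?p, ?q, ?p * ?q}" using Cons.prems by simp
  then consider "d = 1" | "d = ?p" | "d = ?q" | "d = ?p * ?q" by blast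
  then show ?case
  proof cases
    case 1
    then have "d # ds = P_diag (Suc am) a0 ap \<alpha>" by (simp add: ds P_diag_def)
    then show ?thesis by blast
  next
    case 2
    have am: "am = 0" using dvd set_ds(1) unit 2 by blast
    \<comment> \<open>If the tail is coded with the other linear factor, divisibility forces the two
      factors to be equal, so the middle block may be recoded with the opposite sign.\<close>
    have "a0 < 0 \<Longrightarrow> ?q = ?p" using dvd[OF set_ds(3)] lin 2 by metis
    then have "d # ds = P_diag 0 (\<bar>a0\<bar> + 1) ap \<alpha>"
      using am 2 by (auto simp: ds P_diag_def nat_add_distrib)
    then show ?thesis by blast
  next
    case 3
    have am: "am = 0" using dvd set_ds(1) unit 3 by blast
    have "a0 > 0 \<Longrightarrow> ?q = ?p" using dvd[OF set_ds(2)] lin 3 by metis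
    \<comment> \<open>The new middle value is negative even for \<open>a0 = 0\<close>, as
      \<open>P_diag\<close> requires in order to select \<open>[:\<alpha>, 1:]\<close>.\<close>
    moreover have "nat \<bar>- \<bar>a0\<bar> - 1\<bar> = Suc (nat \<bar>a0\<bar>)" by linarith
    ultimately have "d # ds = P_diag 0 (- \<bar>a0\<bar> - 1) ap \<alpha>"
      using am 3 by (cases a0 "0 :: int" rule: linorder_cases) (simp_all add: ds P_diag_def)
    then show ?thesis by blast
  next
    case 4
    have am: "am = 0" using dvd set_ds(1) unit 4 by (metis dvd_mult_left)
    have "\<not> ?p * ?q dvd [:b, 1:]" for b
    proof
      assume "?p * ?q dvd [:b, 1:]"
      from dvd_imp_degree_le[OF this] show False by simp
    qed
    then have "a0 = 0" using dvd set_ds(2,3) 4 by (metis linorder_cases)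
    then have "d # ds = P_diag 0 0 (Suc ap) \<alpha>" using am 4 by (simp add: ds P_diag_def)
    then show ?thesis by blast
  qed
qed

lemma lam_nonzero: "lam \<alpha> \<noteq> 0"
  by (simp add: lam_def)

lemma mat_diag_GL:
  fixes c :: "nat \<Rightarrow> 'a :: field"
  assumes "\<And>i. i < n \<Longrightarrow> c i \<noteq> 0"
  shows "mat_diag n (\<lambda>i. [:c i:]) \<in> GL n"
proof -
  have "mat_diag n (\<lambda>i. [:1 / c i:] * [:c i:]) = 1\<^sub>m n" "mat_diag n (\<lambda>i. [:c i:] * [:1 / c i:]) = 1\<^sub>m n"
    using assms by (auto simp: mat_diag_def)
  then show ?thesis
    unfolding GL_iff by (intro conjI bexI[of _ "mat_diag n (\<lambda>i. [:1 / c i:])"]) auto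
qed

lemma factorization_through_P_mat:
  assumes F: "F \<in> carrier_mat n n" and Y: "Y \<in> carrier_mat n n"
    and FY: "F * Y = lam \<alpha> \<cdot>\<^sub>m 1\<^sub>m n"
  obtains U V am a0 ap where "U \<in> GL n" "V \<in> GL n" "am + nat \<bar>a0\<bar> + ap = n"
    "F = U * P_mat am a0 ap \<alpha> * V"
proof -
  obtain d where d: "mat_equiv n F (mat_diag n d)" "\<And>i j. i \<le> j \<Longrightarrow> j < n \<Longrightarrow> d i dvd d j"
    using smith_normal_form[OF F] by blast
  obtain U V where UV: "U \<in> GL n" "V \<in> GL n" and D: "mat_diag n d = U * F * V"
    using d(1) by (auto simp: mat_equiv_def)
  let ?U = "inv\<^bsub>ring_mat TYPE(complex poly) n ()\<^esub> U" and ?V = "inv\<^bsub>ring_mat TYPE(complex poly) n ()\<^esub> V"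
  note car = UV[THEN GL_carrier] UV[THEN GL_inv(1), THEN GL_carrier] F Y
  \<comment> \<open>The complementary factor Y is carried through the equivalence: with D = U F V,
    the matrix V^{-1} Y U^{-1} again completes D to the scalar matrix. Its diagonal entries then
    show that each d_i divides \<open>lam \<alpha>\<close>.\<close>
  have "mat_diag n d * (?V * Y * ?U) = U * F * (V * (?V * (Y * ?U)))"
    unfolding D using car by (simp add: assoc_mult_mat[of _ n n _ n _ n])
  also have "V * (?V * (Y * ?U)) = V * ?V * (Y * ?U)"
    using car by (intro assoc_mult_mat[symmetric]) auto
  also have "\<dots> = Y * ?U" using car UV by (simp add: GL_inv)
  also have "U * F * (Y * ?U) = U * (F * Y * ?U)"
    using car by (simp add: assoc_mult_mat[of _ n n _ n _ n])
  also have "\<dots> = lam \<alpha> \<cdot>\<^sub>m 1\<^sub>m n"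
    unfolding FY using car UV
    by (simp add: GL_inv mult_smult_distrib[of _ n n _ n] mult_smult_assoc_mat[of _ n n _ n])
  finally have DX: "mat_diag n d * (?V * Y * ?U) = lam \<alpha> \<cdot>\<^sub>m 1\<^sub>m n" .
  have X: "?V * Y * ?U \<in> carrier_mat n n" using car by auto
  have dvd: "d i dvd [:1 - \<alpha>, 1:] * [:\<alpha>, 1:]" if "i < n" for i
  proof -
    have "d i * (?V * Y * ?U) $$ (i,i) = lam \<alpha>"
      using arg_cong[OF DX, of "\<lambda>A. A $$ (i,i)"] that
      unfolding mat_diag_mult_left[OF X] by simp
    then have "d i dvd lam \<alpha>" by (metis dvd_triv_left)
    then show ?thesis by (simp only: lam_def dvd_minus_iff)
  qed
  define X where "X = {1, [:1 - \<alpha>, 1:], [:\<alpha>, 1:], [:1 - \<alpha>, 1:] * [:\<alpha>, 1:]}"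
  have "\<forall>i\<in>{..<n}. \<exists>c x. c \<noteq> 0 \<and> d i = [:c:] * x \<and> x \<in> X"
    using divisors_linear_mult_linear[OF dvd] unfolding X_def by simp
  then obtain c x where cx: "\<forall>i\<in>{..<n}. c i \<noteq> 0 \<and> d i = [:c i:] * x i \<and> x i \<in> X"
    unfolding bchoice_iff by blast
  have c: "c i \<noteq> 0" and dcx: "d i = [:c i:] * x i" and x: "x i \<in> X" if "i < n" for i
    using cx that by simp_all
  \<comment> \<open>Nonzero constants do not affect divisibility, so the chain property passes from
    d to its monic representatives x.\<close>
  have x_dvd: "x i dvd x j" if "i \<le> j" "j < n" for i j
    using d(2)[OF that] c[of i] c[of j] dcx[of i] dcx[of j] that by (simp add: smult_dvd_iff dvd_smult_iff)
  have "sorted_wrt (dvd) (map x [0..<n])"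
    unfolding sorted_wrt_iff_nth_less using x_dvd by simp
  moreover have "set (map x [0..<n]) \<subseteq> X" using x by auto
  ultimately obtain am a0 ap where P: "map x [0..<n] = P_diag am a0 ap \<alpha>"
    using dvd_chain_eq_P_diag unfolding X_def by blast
  have "length (P_diag am a0 ap \<alpha>) = am + nat \<bar>a0\<bar> + ap" by (simp add: P_diag_def)
  with P have n: "am + nat \<bar>a0\<bar> + ap = n" by (metis diff_zero length_map length_upt)
  have "P_diag am a0 ap \<alpha> ! i = x i" if "i < n" for i
    unfolding P[symmetric] using that by simp
  then have P_mat: "P_mat am a0 ap \<alpha> = mat_diag n x"
    unfolding P_mat_def n by (auto simp: mat_diag_def)
  \<comment> \<open>The constants form an invertible diagonal matrix, which the equivalence
    absorbs.\<close>
  have "mat_diag n d = mat_diag n (\<lambda>i. [:c i:]) * mat_diag n x"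
    unfolding mat_diag_diag using dcx by (auto simp: mat_diag_def)
  then have "mat_equiv n (P_mat am a0 ap \<alpha>) (mat_diag n d)"
    unfolding P_mat using mat_equiv_left[OF mat_diag_dim mat_diag_GL[of n c, OF c]] by metis
  then have "mat_equiv n (P_mat am a0 ap \<alpha>) F"
    using mat_equiv_trans mat_equiv_sym[OF F d(1)] P_mat by (metis mat_diag_dim)
  then show ?thesis using that n unfolding mat_equiv_def by metis
qed

subsection \<open>The action of C[h]\<close>

lemma sl2_basis: "sl2_e \<in> sl2" "sl2_f \<in> sl2" "sl2_h \<in> sl2"
  by (auto simp: sl2_def sl2_e_def sl2_f_def sl2_h_def mat_of_rows_list_def)

lemma sl2_add: "x \<in> sl2 \<Longrightarrow> y \<in> sl2 \<Longrightarrow> x + y \<in> sl2"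
proof -
  assume "x \<in> sl2" "y \<in> sl2"
  then show "x + y \<in> sl2"
    by (auto simp: sl2_def) (metis (no_types, lifting) add.commute add.left_commute add.right_neutral)
qed

lemma sl2_smult: "x \<in> sl2 \<Longrightarrow> c \<cdot>\<^sub>m x \<in> sl2"
  by (auto simp: sl2_def) (metis distrib_left mult_zero_right)

lemma sl2_decomposition:
  assumes "x \<in> sl2"
  shows "x = (2 * x $$ (0,0)) \<cdot>\<^sub>m sl2_h + x $$ (0,1) \<cdot>\<^sub>m sl2_e + x $$ (1,0) \<cdot>\<^sub>m sl2_f"
  using assms
  by (intro eq_matI) (auto simp: sl2_def sl2_e_def sl2_f_def sl2_h_def mat_of_rows_list_def less_Suc_eq
      numeral_2_eq_2 add_eq_0_iff)

locale sl2_mod =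
  fixes M :: "'v sl2_rep" (structure)
  assumes sl2_module: "sl2_module M"
begin

sublocale Module.module "class_ring :: complex ring" M
  using sl2_module by (simp add: sl2_module_def)

abbreviation H where "H \<equiv> act M sl2_h"

abbreviation poly_smult :: "complex poly \<Rightarrow> 'v \<Rightarrow> 'v" (infixr \<open>\<star>\<close> 75) where
  "p \<star> v \<equiv> p \<odot>\<^bsub>Uh_module M\<^esub> v"

lemma scale_closed: "v \<in> carrier M \<Longrightarrow> c \<odot> v \<in> carrier M"
  by simp

lemma scale_zero_left [simp]: "v \<in> carrier M \<Longrightarrow> 0 \<odot> v = \<zero>"
  using smult_l_null[of v] by simp

lemma scale_one [simp]: "v \<in> carrier M \<Longrightarrow> 1 \<odot> v = v"
  using smult_one[of v] by simp

lemma scale_l_distr: "v \<in> carrier M \<Longrightarrow> (a + b) \<odot> v = a \<odot> v \<oplus> b \<odot> v"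
  using smult_l_distr[of a b v] by simp

lemma scale_r_distr: "v \<in> carrier M \<Longrightarrow> w \<in> carrier M \<Longrightarrow> a \<odot> (v \<oplus> w) = a \<odot> v \<oplus> a \<odot> w"
  using smult_r_distr[of a v w] by simp

lemma scale_assoc: "v \<in> carrier M \<Longrightarrow> (a * b) \<odot> v = a \<odot> (b \<odot> v)"
  using smult_assoc1[of a b v] by simp

lemma scale_minus_one: "v \<in> carrier M \<Longrightarrow> (-1) \<odot> v = \<ominus> v"
  by (intro minus_equality[symmetric]) (use scale_l_distr[of v "-1" 1] in simp_all)

lemma act_hom:
  assumes "x \<in> sl2"
  shows "v \<in> carrier M \<Longrightarrow> act M x v \<in> carrier M"
    "v \<in> carrier M \<Longrightarrow> w \<in> carrier M \<Longrightarrow> act M x (v \<oplus> w) = act M x v \<oplus> act M x w"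
    "v \<in> carrier M \<Longrightarrow> act M x (c \<odot> v) = c \<odot> act M x v"
proof -
  have hom: "act M x \<in> LinearCombinations.module_hom class_ring M M"
    using sl2_module assms by (simp add: sl2_module_def)
  show "v \<in> carrier M \<Longrightarrow> act M x v \<in> carrier M"
    "v \<in> carrier M \<Longrightarrow> w \<in> carrier M \<Longrightarrow> act M x (v \<oplus> w) = act M x v \<oplus> act M x w"
    "v \<in> carrier M \<Longrightarrow> act M x (c \<odot> v) = c \<odot> act M x v"
    using LinearCombinations.module_hom_closed[OF hom] LinearCombinations.module_hom_add[OF hom] LinearCombinations.module_hom_smult[OF hom, of c] by auto
qed

lemmas act_simps [simp] = sl2_basis[THEN act_hom(1)] sl2_basis[THEN act_hom(2)] sl2_basis[THEN act_hom(3)]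

lemma act_zero: "x \<in> sl2 \<Longrightarrow> act M x \<zero> = \<zero>"
  using act_hom(3)[of x \<zero> 0] act_hom(1)[of x \<zero>] by simp

lemma act_decomposition:
  assumes x: "x \<in> sl2" and v: "v \<in> carrier M"
  shows "act M x v = (2 * x $$ (0,0)) \<odot> H v \<oplus> x $$ (0,1) \<odot> act M sl2_e v \<oplus> x $$ (1,0) \<odot> act M sl2_f v"
proof -
  have add: "act M (y + z) v = act M y v \<oplus> act M z v" if "y \<in> sl2" "z \<in> sl2" for y z
    using sl2_module that v by (simp add: sl2_module_def)
  have scale: "act M (c \<cdot>\<^sub>m y) v = c \<odot> act M y v" if "y \<in> sl2" for c y
    using sl2_module that v by (simp add: sl2_module_def)
  show ?thesis
    by (subst sl2_decomposition[OF x])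
      (simp add: add scale sl2_add sl2_smult sl2_basis)
qed

lemma act_bracket:
  assumes "x \<in> sl2" "y \<in> sl2" "v \<in> carrier M"
  shows "act M x (act M y v) = act M y (act M x v) \<oplus> act M (x * y - y * x) v"
proof -
  have "act M (x * y - y * x) v = act M x (act M y v) \<ominus> act M y (act M x v)"
    using sl2_module assms by (simp add: sl2_module_def)
  then show ?thesis
    using assms by (simp add: act_hom(1) minus_eq a_ac r_neg)
qed

text \<open>The bracket [h,e] = e read as e h = (h - 1) e; this is where \<sigma> comes from.
  Likewise [h,f] = -f gives f h = (h + 1) f and hence \<sigma>_inv.\<close>

lemma h_e: "v \<in> carrier M \<Longrightarrow> act M sl2_e (H v) = H (act M sl2_e v) \<oplus> (-1) \<odot> act M sl2_e v"
  using act_bracket[of sl2_h sl2_e v] sl2_brackets(1)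
  by (simp add: sl2_basis scale_minus_one a_assoc r_neg)

lemma h_f: "v \<in> carrier M \<Longrightarrow> act M sl2_f (H v) = H (act M sl2_f v) \<oplus> act M sl2_f v"
proof -
  assume v: "v \<in> carrier M"
  have "- sl2_f = (-1) \<cdot>\<^sub>m sl2_f" by (rule eq_matI) (auto simp: sl2_f_def mat_of_rows_list_def)
  then have "act M (- sl2_f) v = (-1) \<odot> act M sl2_f v"
    using sl2_module v sl2_basis by (simp add: sl2_module_def)
  with act_bracket[of sl2_h sl2_f v] sl2_brackets(2) v show ?thesis
    by (simp add: sl2_basis scale_minus_one a_assoc l_neg)
qed

section \<open>The C[h]-module structure given by h\<close>

lemma H_funpow_closed [simp]: "v \<in> carrier M \<Longrightarrow> (H ^^ k) v \<in> carrier M"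
  by (induction k) auto

text \<open>A free upper bound N avoids tracking how the exact degree changes under
  \<open>pCons\<close>, where the zero polynomial is exceptional.\<close>

lemma poly_smult_eq_finsum:
  assumes v: "v \<in> carrier M" and N: "degree p \<le> N"
  shows "p \<star> v = (\<Oplus>k\<in>{..N}. coeff p k \<odot> (H ^^ k) v)"
proof -
  have "(\<Oplus>k\<in>{..degree p}. coeff p k \<odot> (H ^^ k) v) = (\<Oplus>k\<in>{..N}. coeff p k \<odot> (H ^^ k) v)"
    using v N by (intro add.finprod_mono_neutral_cong_left) (auto simp: coeff_eq_0)
  then show ?thesis by (simp add: Uh_module_def)
qed

lemma poly_smult_closed [simp]: "v \<in> carrier M \<Longrightarrow> p \<star> v \<in> carrier M"
  by (auto simp: Uh_module_def intro!: finsum_closed)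

lemma poly_smult_zero [simp]: "v \<in> carrier M \<Longrightarrow> 0 \<star> v = \<zero>"
  by (simp add: Uh_module_def)

lemma H_finsum:
  "f \<in> {..n :: nat} \<rightarrow> carrier M \<Longrightarrow> H (\<Oplus>k\<in>{..n}. f k) = (\<Oplus>k\<in>{..n}. H (f k))"
  by (induction n) (auto simp: Pi_def finsum_Suc)

text \<open>Horner's rule. It replaces the sum over coefficients by a recursion, so that the module
  laws follow by induction on polynomials.\<close>

lemma poly_smult_pCons [simp]:
  assumes v: "v \<in> carrier M"
  shows "pCons a p \<star> v = a \<odot> v \<oplus> H (p \<star> v)"
proof -
  have "pCons a p \<star> v = (\<Oplus>k\<in>{..Suc (degree p)}. coeff (pCons a p) k \<odot> (H ^^ k) v)"
    using v by (intro poly_smult_eq_finsum) (auto simp: degree_pCons_le)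
  also have "\<dots> = (\<Oplus>k\<in>{..degree p}. coeff p k \<odot> H ((H ^^ k) v)) \<oplus> a \<odot> v"
    using v by (subst finsum_Suc2) auto
  also have "(\<Oplus>k\<in>{..degree p}. coeff p k \<odot> H ((H ^^ k) v)) = H (\<Oplus>k\<in>{..degree p}. coeff p k \<odot> (H ^^ k) v)"
    using v by (subst H_finsum) auto
  also have "\<dots> = H (p \<star> v)" by (simp add: Uh_module_def)
  finally show ?thesis using v by (simp add: a_comm)
qed

lemma poly_smult_const: "v \<in> carrier M \<Longrightarrow> [:c:] \<star> v = c \<odot> v"
  by (simp add: act_zero sl2_basis)

lemma poly_smult_one [simp]: "v \<in> carrier M \<Longrightarrow> 1 \<star> v = v"
  using poly_smult_const[of v 1] by (simp add: one_pCons)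

lemma poly_smult_add_left:
  "v \<in> carrier M \<Longrightarrow> (p + q) \<star> v = p \<star> v \<oplus> q \<star> v"
  by (induction p q rule: poly_induct2) (auto simp: scale_l_distr a_ac)

lemma poly_smult_add_right:
  "v \<in> carrier M \<Longrightarrow> w \<in> carrier M \<Longrightarrow> p \<star> (v \<oplus> w) = p \<star> v \<oplus> p \<star> w"
  by (induction p) (auto simp: scale_r_distr a_ac)

lemma poly_smult_smult:
  "v \<in> carrier M \<Longrightarrow> Polynomial.smult a q \<star> v = a \<odot> (q \<star> v)"
  by (induction q) (auto simp: scale_assoc scale_r_distr)

lemma poly_smult_mult:
  "v \<in> carrier M \<Longrightarrow> (p * q) \<star> v = p \<star> (q \<star> v)"
proof (induction p)
  case (pCons a p)
  then show ?case
    by (simp add: poly_smult_add_left poly_smult_smult)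
qed simp

lemma Uh_module: "Module.module class_ring (Uh_module M)"
proof (rule module_criteria)
  show "\<forall>v\<in>carrier (Uh_module M). \<exists>neg_v\<in>carrier (Uh_module M). v \<oplus>\<^bsub>Uh_module M\<^esub> neg_v = \<zero>\<^bsub>Uh_module M\<^esub>"
    by (auto simp: Uh_module_def intro!: bexI[of _ "\<ominus> _"] r_neg)
qed (use class_cring.cring_axioms poly_smult_add_left poly_smult_add_right poly_smult_mult poly_smult_closed poly_smult_one
     in \<open>auto simp: Uh_module_def a_ac class_ring_simps\<close>)

text \<open>A commutation rule T h = r(h) T propagates from h to every polynomial in h, turning p(h)
  into p(r(h)). The choices r = h - 1 and r = h + 1 give the semilinearity of e and f.\<close>

lemma poly_smult_semilinear:
  assumes closed: "\<And>v. v \<in> carrier M \<Longrightarrow> T v \<in> carrier M"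
    and add: "\<And>v w. v \<in> carrier M \<Longrightarrow> w \<in> carrier M \<Longrightarrow> T (v \<oplus> w) = T v \<oplus> T w"
    and scale: "\<And>c v. v \<in> carrier M \<Longrightarrow> T (c \<odot> v) = c \<odot> T v"
    and H: "\<And>v. v \<in> carrier M \<Longrightarrow> T (H v) = r \<star> T v"
    and v: "v \<in> carrier M"
  shows "T (p \<star> v) = (p \<circ>\<^sub>p r) \<star> T v"
proof (induction p)
  case 0
  have "T (0 \<odot> v) = 0 \<odot> T v" using scale v .
  then show ?case using v closed by simp
next
  case (pCons a p)
  then show ?case
    using v by (simp add: closed add scale H pcompose_pCons poly_smult_add_left poly_smult_mult poly_smult_const
      del: poly_smult_pCons(1)) (simp add: closed add scale H poly_smult_pCons)
qed

lemma act_e_poly_smult: "v \<in> carrier M \<Longrightarrow> act M sl2_e (p \<star> v) = \<sigma> p \<star> act M sl2_e v"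
  unfolding \<sigma>_def by (rule poly_smult_semilinear) (auto simp: h_e a_comm sl2_basis act_zero)

lemma act_f_poly_smult: "v \<in> carrier M \<Longrightarrow> act M sl2_f (p \<star> v) = \<sigma>_inv p \<star> act M sl2_f v"
  unfolding \<sigma>_inv_def
  by (rule poly_smult_semilinear) (auto simp: h_f a_comm sl2_basis act_zero)

text \<open>The Casimir equation solved for fe. The constant in \<open>lam\<close> fits because
  (2\<alpha> - 1)^2 - (2h + 1)^2 = 4 \<open>lam \<alpha>\<close>.\<close>

lemma act_f_e:
  assumes "has_central_character M ((2 * \<alpha> - 1)\<^sup>2)" and v: "v \<in> carrier M"
  shows "act M sl2_f (act M sl2_e v) = lam \<alpha> \<star> v"
proof -
  let ?fe = "act M sl2_f (act M sl2_e v)"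
  \<comment> \<open>The inner operator of \<open>casimir\<close> is multiplication by 2h + 1, so its
    square is a polynomial action as well.\<close>
  have t: "2 \<odot> H w \<oplus> w = [:1, 2:] \<star> w" if "w \<in> carrier M" for w
    using that by (simp add: act_zero sl2_basis a_comm)
  have "([:1, 2:] * [:1, 2:]) \<star> v \<oplus> 4 \<odot> ?fe = casimir M v"
    using v by (simp only: casimir_def Let_def t poly_smult_closed poly_smult_mult)
  also have "\<dots> = [:(2 * \<alpha> - 1)\<^sup>2:] \<star> v"
    using assms by (simp only: has_central_character_def poly_smult_const)
  also have "[:(2 * \<alpha> - 1)\<^sup>2:] = [:1, 2:] * [:1, 2:] + [:4:] * lam \<alpha>"
    by (simp add: lam_def power2_eq_square algebra_simps)
  also have "\<dots> \<star> v = ([:1, 2:] * [:1, 2:]) \<star> v \<oplus> 4 \<odot> (lam \<alpha> \<star> v)"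
    using v by (simp only: poly_smult_add_left poly_smult_mult poly_smult_const poly_smult_closed)
  finally have "4 \<odot> ?fe = 4 \<odot> (lam \<alpha> \<star> v)"
    using v by (metis r_neg1 poly_smult_closed act_simps(1,2) scale_closed)
  then have "(1/4) \<odot> (4 \<odot> ?fe) = (1/4) \<odot> (4 \<odot> (lam \<alpha> \<star> v))" by simp
  then show ?thesis
    using v by (simp flip: scale_assoc)
qed

end

subsection \<open>Coordinates\<close>

lemma comm_ring_hom_pcompose: "comm_ring_hom (\<lambda>p :: 'a :: comm_ring_1 poly. p \<circ>\<^sub>p r)"
  by unfold_locales (simp_all add: pcompose_add pcompose_mult pcompose_1)

interpretation \<sigma>: comm_ring_hom \<sigma>
  using comm_ring_hom_pcompose by (simp add: \<sigma>_def [abs_def])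

interpretation \<sigma>_inv: comm_ring_hom \<sigma>_inv
  using comm_ring_hom_pcompose by (simp add: \<sigma>_inv_def [abs_def])

lemma map_vec_\<sigma>_inverse: "map_vec \<sigma> (map_vec \<sigma>_inv g) = g" "map_vec \<sigma>_inv (map_vec \<sigma> g) = g"
  by (auto simp: \<sigma>_inverse)

lemma map_mat_\<sigma>_inverse: "map_mat \<sigma> (map_mat \<sigma>_inv A) = A" "map_mat \<sigma>_inv (map_mat \<sigma> A) = A"
  by (auto simp: \<sigma>_inverse intro!: eq_matI)

lemma (in comm_ring_hom) map_mat_GL:
  assumes "U \<in> GL n" shows "map_mat hom U \<in> GL n"
proof -
  obtain V where V: "V \<in> carrier_mat n n" "V * U = 1\<^sub>m n" "U * V = 1\<^sub>m n"
    using assms by (auto simp: GL_iff)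
  have U: "U \<in> carrier_mat n n" using assms by (rule GL_carrier)
  have "map_mat hom V * map_mat hom U = 1\<^sub>m n" "map_mat hom U * map_mat hom V = 1\<^sub>m n"
    using mat_hom_mult[OF V(1) U] mat_hom_mult[OF U V(1)] V mat_hom_one by simp_all
  with U V(1) show ?thesis unfolding GL_iff by (intro conjI bexI[of _ "map_mat hom V"]) auto
qed

lemma vec_truncate_Suc:
  fixes g :: "'a :: comm_ring_1 vec"
  assumes "g \<in> carrier_vec n" "k < n"
  shows "vec n (\<lambda>i. if i < Suc k then g $ i else 0)
    = vec n (\<lambda>i. if i < k then g $ i else 0) + g $ k \<cdot>\<^sub>v unit_vec n k"
  using assms by (intro eq_vecI) (auto simp: less_Suc_eq)

lemma mult_mat_smult_vec:
  fixes A :: "'a :: comm_ring_1 mat"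
  assumes "A \<in> carrier_mat m n" "g \<in> carrier_vec n"
  shows "A *\<^sub>v (p \<cdot>\<^sub>v g) = p \<cdot>\<^sub>v (A *\<^sub>v g)"
  using assms by (intro eq_vecI) (auto simp: scalar_prod_smult_distrib[of _ n])

context sl2_mod
begin

text \<open>An ordered C[h]-basis of M, encoded as the linear isomorphism from column vectors to M.
  In this direction a change of basis is precomposition with an invertible matrix.\<close>

definition coordinates :: "nat \<Rightarrow> (complex poly vec \<Rightarrow> 'v) \<Rightarrow> bool" where
  "coordinates n \<psi> \<longleftrightarrow> bij_betw \<psi> (carrier_vec n) (carrier M) \<and>
     (\<forall>g\<in>carrier_vec n. \<forall>g'\<in>carrier_vec n. \<psi> (g + g') = \<psi> g \<oplus> \<psi> g') \<and>
     (\<forall>p. \<forall>g\<in>carrier_vec n. \<psi> (p \<cdot>\<^sub>v g) = p \<star> \<psi> g)"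

lemma coordinatesD:
  assumes "coordinates n \<psi>" "g \<in> carrier_vec n"
  shows "\<psi> g \<in> carrier M"
    "g' \<in> carrier_vec n \<Longrightarrow> \<psi> (g + g') = \<psi> g \<oplus> \<psi> g'"
    "\<psi> (p \<cdot>\<^sub>v g) = p \<star> \<psi> g"
    "g' \<in> carrier_vec n \<Longrightarrow> \<psi> g = \<psi> g' \<longleftrightarrow> g = g'"
  using assms by (auto simp: coordinates_def bij_betw_def inj_on_def)

lemma coordinates_surj:
  assumes "coordinates n \<psi>" "v \<in> carrier M"
  obtains g where "g \<in> carrier_vec n" "\<psi> g = v"
proof -
  have "v \<in> \<psi> ` carrier_vec n" using assms by (simp add: coordinates_def bij_betw_def)
  then show ?thesis using that by blast
qed

lemma coordinates_exist:
  assumes "free_of_rank class_ring (Uh_module M) n"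
  obtains \<psi> where "coordinates n \<psi>"
proof -
  let ?U = "Uh_module M"
  interpret U: Module.module class_ring ?U by (rule Uh_module)
  have carrier_U [simp]: "carrier ?U = carrier M" and add_U [simp]: "add ?U = add M"
    and zero_U [simp]: "zero ?U = zero M"
    by (simp_all add: Uh_module_def)
  obtain B where B: "B \<subseteq> carrier M" "finite B" "card B = n" "\<not> U.lin_dep B" "U.span B = carrier M"
    using assms unfolding free_of_rank_def by auto
  obtain f where f: "bij_betw f B {..<n}"
    using B(2,3) by (metis ex_bij_betw_finite_nat atLeast0LessThan)
  define \<psi> where "\<psi> g = U.lincomb (\<lambda>v. g $ f v) B" for g
  have f_less: "v \<in> B \<Longrightarrow> f v < n" for v using f by (auto simp: bij_betw_def)
  have closed: "\<psi> g \<in> carrier M" for g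
    using U.lincomb_closed[of B] B(1) by (simp add: \<psi>_def)
  have add: "\<psi> (g + g') = \<psi> g \<oplus> \<psi> g'" if "g \<in> carrier_vec n" "g' \<in> carrier_vec n" for g g'
  proof -
    have "(\<Oplus>\<^bsub>?U\<^esub>v\<in>B. g $ f v \<star> v \<oplus>\<^bsub>?U\<^esub> g' $ f v \<star> v) = \<psi> g \<oplus>\<^bsub>?U\<^esub> \<psi> g'"
      unfolding \<psi>_def U.lincomb_def using B(1) by (intro U.finsum_addf) (auto simp: subset_iff)
    moreover have "(\<Oplus>\<^bsub>?U\<^esub>v\<in>B. g $ f v \<star> v \<oplus>\<^bsub>?U\<^esub> g' $ f v \<star> v) = \<psi> (g + g')"
      unfolding \<psi>_def U.lincomb_def using B(1) that f_less
      by (intro U.finsum_cong2) (auto simp: poly_smult_add_left subset_iff)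
    ultimately show ?thesis by simp
  qed
  have scale: "\<psi> (p \<cdot>\<^sub>v g) = p \<star> \<psi> g" if "g \<in> carrier_vec n" for p g
  proof -
    have "p \<star> \<psi> g = U.lincomb (\<lambda>v. p * g $ f v) B"
      using U.lincomb_smult[of B "\<lambda>v. g $ f v" p] B(1) by (simp add: \<psi>_def)
    also have "\<dots> = \<psi> (p \<cdot>\<^sub>v g)"
      unfolding \<psi>_def using B(1) that f_less by (intro U.lincomb_cong) auto
    finally show ?thesis ..
  qed
  have zero: "g = 0\<^sub>v n" if "g \<in> carrier_vec n" "\<psi> g = \<zero>" for g
  proof (rule eq_vecI)
    fix i assume i: "i < dim_vec (0\<^sub>v n :: complex poly vec)"
    then have "i \<in> f ` B" using f by (simp add: bij_betw_def)
    then obtain v where v: "v \<in> B" "f v = i" by blast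
    have "g $ f v = 0"
    proof (rule ccontr)
      assume "g $ f v \<noteq> 0"
      then have "U.lin_dep B"
        using that(2) v(1) by (intro U.lin_dep_crit[OF B(2) subset_refl, of "\<lambda>v. g $ f v"]) (auto simp: \<psi>_def)
      with B(4) show False ..
    qed
    with v i show "g $ i = 0\<^sub>v n $ i" by simp
  qed (use that in simp)
  have "inj_on \<psi> (carrier_vec n)"
  proof (rule inj_onI)
    fix g g' :: "complex poly vec"
    assume g: "g \<in> carrier_vec n" "g' \<in> carrier_vec n" "\<psi> g = \<psi> g'"
    \<comment> \<open>Injectivity is reduced to the trivial kernel; the difference is written with
      the scalar -1 so that \<open>add\<close> and \<open>scale\<close> evaluate it.\<close>
    have "\<psi> (g + (-1) \<cdot>\<^sub>v g') = \<psi> g' \<oplus> (-1) \<star> \<psi> g'"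
      using g by (simp add: add scale)
    also have "\<dots> = (1 + (-1)) \<star> \<psi> g'"
      by (simp only: poly_smult_add_left closed poly_smult_one)
    also have "\<dots> = \<zero>" by (simp add: closed)
    finally have "g + (-1) \<cdot>\<^sub>v g' = 0\<^sub>v n" using g by (intro zero) auto
    then show "g = g'"
      using g by (auto simp: vec_eq_iff)
  qed
  moreover have "carrier M \<subseteq> \<psi> ` carrier_vec n"
  proof
    fix v assume "v \<in> carrier M"
    then have "v \<in> U.span B" using B(5) by simp
    then obtain a where a: "U.lincomb a B = v"
      using U.finite_in_span[OF B(2)] B(1) by auto
    have "\<psi> (vec n (\<lambda>i. a (the_inv_into B f i))) = U.lincomb a B"
      unfolding \<psi>_def using B(1) f_less f
      by (intro U.lincomb_cong) (auto simp: bij_betw_def the_inv_into_f_f)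
    with a show "v \<in> \<psi> ` carrier_vec n" by (intro image_eqI[of _ _ "vec n (\<lambda>i. a (the_inv_into B f i))"]) auto
  qed
  ultimately have "bij_betw \<psi> (carrier_vec n) (carrier M)"
    using closed by (auto simp: bij_betw_def)
  with add scale show ?thesis
    by (intro that[of \<psi>]) (auto simp: coordinates_def)
qed

text \<open>As for linear maps, the columns of A are the coordinates of T on the standard basis. The
  twist appears because T takes g_k times a basis vector to \<tau>(g_k) times its image.\<close>

lemma semilinear_matrix:
  assumes \<psi>: "coordinates n \<psi>"
    and closed: "\<And>v. v \<in> carrier M \<Longrightarrow> T v \<in> carrier M"
    and add: "\<And>v w. v \<in> carrier M \<Longrightarrow> w \<in> carrier M \<Longrightarrow> T (v \<oplus> w) = T v \<oplus> T w"
    and scale: "\<And>p v. v \<in> carrier M \<Longrightarrow> T (p \<star> v) = \<tau> p \<star> T v"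
    and "comm_ring_hom \<tau>"
  obtains A where "A \<in> carrier_mat n n"
    "\<And>g. g \<in> carrier_vec n \<Longrightarrow> T (\<psi> g) = \<psi> (A *\<^sub>v map_vec \<tau> g)"
proof -
  interpret comm_ring_hom \<tau> by fact
  note \<psi>D = coordinatesD[OF \<psi>]
  have "\<exists>a\<in>carrier_vec n. \<psi> a = T (\<psi> (unit_vec n j))" for j
    using coordinates_surj[OF \<psi> closed[OF \<psi>D(1)]] by (metis unit_vec_carrier)
  then obtain a where a: "\<And>j. a j \<in> carrier_vec n" "\<And>j. \<psi> (a j) = T (\<psi> (unit_vec n j))"
    by metis
  define A where "A = mat n n (\<lambda>(i,j). a j $ i)"
  have A: "A \<in> carrier_mat n n" by (simp add: A_def)
  have A_unit: "A *\<^sub>v unit_vec n k = a k" if "k < n" for k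
    using that a(1)[of k] A by (intro eq_vecI) (auto simp: A_def)
  have "T (\<psi> g) = \<psi> (A *\<^sub>v map_vec \<tau> g)" if g: "g \<in> carrier_vec n" for g
  proof -
    \<comment> \<open>Truncations build g one coordinate at a time, so that additivity and
      semilinearity can be used by induction on k.\<close>
    define t where "t k = vec n (\<lambda>i. if i < k then g $ i else 0)" for k
    have t: "t k \<in> carrier_vec n" for k by (simp add: t_def)
    have "T (\<psi> (t k)) = \<psi> (A *\<^sub>v map_vec \<tau> (t k))" if "k \<le> n" for k
      using that
    proof (induction k)
      case 0
      have t0: "t 0 = 0\<^sub>v n" by (auto simp: t_def)
      have "0 \<cdot>\<^sub>v 0\<^sub>v n = (0\<^sub>v n :: complex poly vec)" by auto
      then have \<psi>0: "\<psi> (0\<^sub>v n) = \<zero>"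
        using \<psi>D(3)[of "0\<^sub>v n" 0] \<psi>D(1)[of "0\<^sub>v n"] by simp
      have "T \<zero> = \<zero>" using scale[of \<zero> 0] closed[of \<zero>] by simp
      moreover have "A *\<^sub>v 0\<^sub>v n = 0\<^sub>v n" using A by (intro eq_vecI) auto
      ultimately show ?case by (simp add: t0 \<psi>0 vec_hom_zero)
    next
      case (Suc k)
      then have k: "k < n" by simp
      have tS: "t (Suc k) = t k + g $ k \<cdot>\<^sub>v unit_vec n k"
        unfolding t_def by (rule vec_truncate_Suc[OF g k])
      \<comment> \<open>A ring homomorphism fixes 0 and 1, hence the unit vectors; only the
        coefficient is twisted.\<close>
      have map_tS: "map_vec \<tau> (t (Suc k)) = map_vec \<tau> (t k) + \<tau> (g $ k) \<cdot>\<^sub>v unit_vec n k"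
        unfolding tS using t[of k] k by (intro eq_vecI) (auto simp: hom_add hom_mult)
      have "T (\<psi> (t (Suc k))) = T (\<psi> (t k)) \<oplus> \<tau> (g $ k) \<star> T (\<psi> (unit_vec n k))"
        unfolding tS using t[of k] by (simp add: \<psi>D add scale)
      also have "\<dots> = \<psi> (A *\<^sub>v map_vec \<tau> (t k)) \<oplus> \<psi> (\<tau> (g $ k) \<cdot>\<^sub>v (A *\<^sub>v unit_vec n k))"
        using Suc k a by (simp add: \<psi>D A_unit)
      also have "\<dots> = \<psi> (A *\<^sub>v map_vec \<tau> (t k) + A *\<^sub>v (\<tau> (g $ k) \<cdot>\<^sub>v unit_vec n k))"
        using A t[of k] by (simp add: \<psi>D(2) mult_mat_smult_vec[of _ n n])
      also have "\<dots> = \<psi> (A *\<^sub>v map_vec \<tau> (t (Suc k)))"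
        unfolding map_tS using A t[of k] by (simp add: mult_add_distrib_mat_vec[of _ n n])
      finally show ?case .
    qed
    moreover have "t n = g" using g by (auto simp: t_def)
    ultimately show ?thesis by force
  qed
  with A show ?thesis by (rule that)
qed

lemma coordinates_change:
  assumes \<psi>: "coordinates n \<psi>" and U: "U \<in> GL n"
  shows "coordinates n (\<lambda>g. \<psi> (U *\<^sub>v g))"
proof -
  obtain V where V: "V \<in> carrier_mat n n" "V * U = 1\<^sub>m n" "U * V = 1\<^sub>m n"
    using U by (auto simp: GL_iff)
  have Uc: "U \<in> carrier_mat n n" using U by (rule GL_carrier)
  have "bij_betw (\<lambda>g. U *\<^sub>v g) (carrier_vec n) (carrier_vec n)"
    by (rule bij_betw_byWitness[where f' = "\<lambda>g. V *\<^sub>v g"])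
      (use V Uc in \<open>auto simp flip: assoc_mult_mat_vec\<close>)
  then have "bij_betw (\<psi> \<circ> (\<lambda>g. U *\<^sub>v g)) (carrier_vec n) (carrier M)"
    using \<psi> by (intro bij_betw_trans) (auto simp: coordinates_def)
  moreover have "\<psi> (U *\<^sub>v (p \<cdot>\<^sub>v g)) = p \<star> \<psi> (U *\<^sub>v g)" if "g \<in> carrier_vec n" for p g
    using coordinatesD(3)[OF \<psi>, of "U *\<^sub>v g" p] that Uc by (simp add: mult_mat_smult_vec[of _ n n])
  moreover have "\<psi> (U *\<^sub>v (g + g')) = \<psi> (U *\<^sub>v g) \<oplus> \<psi> (U *\<^sub>v g')"
    if "g \<in> carrier_vec n" "g' \<in> carrier_vec n" for g g'
    using coordinatesD(2)[OF \<psi>, of "U *\<^sub>v g" "U *\<^sub>v g'"] that Uc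
    by (simp add: mult_add_distrib_mat_vec[of _ n n])
  ultimately show ?thesis by (simp add: coordinates_def comp_def)
qed

text \<open>The isomorphism is the inverse of \<psi>. Compatibility with h is automatic, since h
  acts as the polynomial \<open>[:0, 1:]\<close> and \<psi> is C[h]-linear; a general x is a
  combination of h, e and f.\<close>

lemma sl2_isomorphic_M_EF:
  assumes \<psi>: "coordinates n \<psi>" and E: "E \<in> carrier_mat n n" and F: "F \<in> carrier_mat n n"
    and e: "\<And>g. g \<in> carrier_vec n \<Longrightarrow> act M sl2_e (\<psi> g) = \<psi> (E *\<^sub>v map_vec \<sigma> g)"
    and f: "\<And>g. g \<in> carrier_vec n \<Longrightarrow> act M sl2_f (\<psi> g) = \<psi> (F *\<^sub>v map_vec \<sigma>_inv g)"
  shows "sl2_isomorphic M (M_EF n E F)"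
proof -
  let ?N = "M_EF n E F"
  note \<psi>D = coordinatesD[OF \<psi>]
  define \<phi> where "\<phi> = the_inv_into (carrier_vec n) \<psi>"
  have bij: "bij_betw \<psi> (carrier_vec n) (carrier M)" using \<psi> by (simp add: coordinates_def)
  have \<phi>_bij: "bij_betw \<phi> (carrier M) (carrier_vec n)"
    unfolding \<phi>_def using bij by (rule bij_betw_the_inv_into)
  have \<phi>\<psi>: "\<phi> (\<psi> g) = g" if "g \<in> carrier_vec n" for g
    unfolding \<phi>_def using bij that by (auto simp: bij_betw_def the_inv_into_f_f)
  have N: "carrier ?N = carrier_vec n" "add ?N = (+)" "Module.smult ?N = (\<lambda>c g. [:c:] \<cdot>\<^sub>v g)"
    by (simp_all add: M_EF_def)
  have "\<phi> \<in> LinearCombinations.module_hom class_ring M ?N"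
    unfolding LinearCombinations.module_hom_def N
  proof (intro CollectI conjI allI impI)
    show "\<phi> \<in> carrier M \<rightarrow> carrier_vec n" using \<phi>_bij by (auto simp: bij_betw_def)
  next
    fix v w assume "v \<in> carrier M \<and> w \<in> carrier M"
    then obtain g g' where "g \<in> carrier_vec n" "\<psi> g = v" "g' \<in> carrier_vec n" "\<psi> g' = w"
      using coordinates_surj[OF \<psi>] by metis
    then show "\<phi> (v \<oplus> w) = \<phi> v + \<phi> w" by (metis \<phi>\<psi> \<psi>D(2) add_carrier_vec)
  next
    fix c :: complex and v assume "c \<in> carrier class_ring \<and> v \<in> carrier M"
    then obtain g where g: "g \<in> carrier_vec n" "\<psi> g = v"
      using coordinates_surj[OF \<psi>] by metis
    have "c \<odot> v = \<psi> ([:c:] \<cdot>\<^sub>v g)"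
      using \<psi>D(1,3)[OF g(1)] g(2) by (simp only: poly_smult_const)
    then show "\<phi> (c \<odot> v) = [:c:] \<cdot>\<^sub>v \<phi> v" using g by (metis \<phi>\<psi> smult_carrier_vec)
  qed
  moreover have "\<phi> (act M x v) = act ?N x (\<phi> v)" if x: "x \<in> sl2" and v: "v \<in> carrier M" for x v
  proof -
    obtain g where g: "g \<in> carrier_vec n" "\<psi> g = v"
      using coordinates_surj[OF \<psi> v] .
    let ?h = "[:0, 1:] \<cdot>\<^sub>v g" and ?e = "E *\<^sub>v map_vec \<sigma> g" and ?f = "F *\<^sub>v map_vec \<sigma>_inv g"
    have car: "?h \<in> carrier_vec n" "?e \<in> carrier_vec n" "?f \<in> carrier_vec n"
      using g E F by auto
    have h: "H v = \<psi> ?h"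
      unfolding \<psi>D(3)[OF g(1)] g(2) using v by (simp add: act_zero sl2_basis)
    have "act M x v = (2 * x $$ (0,0)) \<odot> \<psi> ?h \<oplus> x $$ (0,1) \<odot> \<psi> ?e \<oplus> x $$ (1,0) \<odot> \<psi> ?f"
      using act_decomposition[OF x v] h e[OF g(1)] f[OF g(1)] by (simp add: g(2))
    also have "\<dots> = \<psi> ([:2 * x $$ (0,0):] \<cdot>\<^sub>v ?h + [:x $$ (0,1):] \<cdot>\<^sub>v ?e + [:x $$ (1,0):] \<cdot>\<^sub>v ?f)"
      using car by (simp only: \<psi>D(2,3) smult_carrier_vec add_carrier_vec poly_smult_const poly_smult_closed \<psi>D(1))
    also have "\<dots> = \<psi> (act ?N x g)" by (simp add: M_EF_def)
    finally have "\<phi> (act M x v) = \<phi> (\<psi> (act ?N x g))" by simp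
    moreover have "act ?N x g \<in> carrier_vec n" using car by (simp add: M_EF_def)
    ultimately show ?thesis using g \<phi>\<psi> by metis
  qed
  ultimately show ?thesis
    unfolding sl2_isomorphic_def using \<phi>_bij N(1) by metis
qed

end

subsection \<open>The normal form\<close>

lemma P_mat_carrier: "P_mat am a0 ap \<alpha> \<in> carrier_mat (am + nat \<bar>a0\<bar> + ap) (am + nat \<bar>a0\<bar> + ap)"
  by (simp add: P_mat_def)

lemma Pbar_mat_carrier: "Pbar_mat am a0 ap \<alpha> \<in> carrier_mat (am + nat \<bar>a0\<bar> + ap) (am + nat \<bar>a0\<bar> + ap)"
  by (simp add: Pbar_mat_def)

lemma Pbar_P:
  assumes "am + nat \<bar>a0\<bar> + ap = n"
  shows "Pbar_mat am a0 ap \<alpha> * P_mat am a0 ap \<alpha> = lam \<alpha> \<cdot>\<^sub>m 1\<^sub>m n"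
    "P_mat am a0 ap \<alpha> * Pbar_mat am a0 ap \<alpha> = lam \<alpha> \<cdot>\<^sub>m 1\<^sub>m n"
proof -
  show *: "Pbar_mat am a0 ap \<alpha> * P_mat am a0 ap \<alpha> = lam \<alpha> \<cdot>\<^sub>m 1\<^sub>m n"
    using Pbar_mat_unique[of "Pbar_mat am a0 ap \<alpha>" am a0 ap \<alpha>] by (simp add: assms)
  have "P_mat am a0 ap \<alpha> * Pbar_mat am a0 ap \<alpha> = Pbar_mat am a0 ap \<alpha> * P_mat am a0 ap \<alpha>"
    by (simp add: P_mat_def Pbar_mat_def mult.commute)
  with * show "P_mat am a0 ap \<alpha> * Pbar_mat am a0 ap \<alpha> = lam \<alpha> \<cdot>\<^sub>m 1\<^sub>m n" by simp
qed

text \<open>\<open>lam \<alpha>\<close> is -(h^2 + h) plus a constant, and h^2 + h drops by 2h under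
  the shift. This difference is the right-hand side in \<open>admissible\<close>.\<close>

lemma \<sigma>_lam: "\<sigma> (lam \<alpha>) = lam \<alpha> + [:0, 2:]"
  by (simp add: \<sigma>_def lam_def pcompose_uminus pcompose_mult pcompose_pCons algebra_simps)

context
  fixes n am ap :: nat and a0 :: int and \<alpha> :: complex and K K' :: "complex poly mat"
  assumes carrier: "K \<in> carrier_mat n n" "K' \<in> carrier_mat n n"
    and inverse: "K * K' = 1\<^sub>m n" "K' * K = 1\<^sub>m n"
    and n: "am + nat \<bar>a0\<bar> + ap = n"
begin

lemma normal_form_carrier:
  "K \<in> carrier_mat n n" "K' \<in> carrier_mat n n"
  "P_mat am a0 ap \<alpha> \<in> carrier_mat n n" "Pbar_mat am a0 ap \<alpha> \<in> carrier_mat n n"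
  using carrier P_mat_carrier[of am a0 ap \<alpha>] Pbar_mat_carrier[of am a0 ap \<alpha>] n by auto

lemma normal_form_F_E: "(P_mat am a0 ap \<alpha> * K) * (K' * Pbar_mat am a0 ap \<alpha>) = lam \<alpha> \<cdot>\<^sub>m 1\<^sub>m n"
proof -
  let ?P = "P_mat am a0 ap \<alpha>" and ?Q = "Pbar_mat am a0 ap \<alpha>"
  note car = normal_form_carrier
  have "?P * K * (K' * ?Q) = ?P * (K * (K' * ?Q))"
    using car by (intro assoc_mult_mat) auto
  also have "K * (K' * ?Q) = K * K' * ?Q"
    using car by (intro assoc_mult_mat[symmetric]) auto
  also have "\<dots> = ?Q" using car inverse(1) by simp
  finally show ?thesis by (simp add: Pbar_P(2)[OF n])
qed

text \<open>The inner product is the scalar matrix \<open>lam \<alpha>\<close>, which commutes with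
  K, so the outer K' and K cancel.\<close>

lemma normal_form_E_F: "(K' * Pbar_mat am a0 ap \<alpha>) * (P_mat am a0 ap \<alpha> * K) = lam \<alpha> \<cdot>\<^sub>m 1\<^sub>m n"
proof -
  let ?P = "P_mat am a0 ap \<alpha>" and ?Q = "Pbar_mat am a0 ap \<alpha>"
  note car = normal_form_carrier
  have "K' * ?Q * (?P * K) = K' * (?Q * (?P * K))"
    using car by (intro assoc_mult_mat) auto
  also have "?Q * (?P * K) = ?Q * ?P * K"
    using car by (intro assoc_mult_mat[symmetric]) auto
  also have "\<dots> = lam \<alpha> \<cdot>\<^sub>m K"
    unfolding Pbar_P(1)[OF n] using car by (simp add: mult_smult_assoc_mat[of _ n n _ n])
  also have "K' * \<dots> = lam \<alpha> \<cdot>\<^sub>m 1\<^sub>m n"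
    using car inverse(2) by (simp add: mult_smult_distrib[of _ n n _ n])
  finally show ?thesis .
qed

text \<open>Both products are scalar: E \<sigma>(F) is \<sigma> of the product K' Pbar P K, hence
  \<sigma>(lam), and F \<sigma>_inv(E) is lam. The relation thus holds for every invertible
  K.\<close>

lemma normal_form_admissible:
  "admissible n (map_mat \<sigma> (K' * Pbar_mat am a0 ap \<alpha>)) (P_mat am a0 ap \<alpha> * K)"
proof -
  let ?P = "P_mat am a0 ap \<alpha>" and ?Q = "Pbar_mat am a0 ap \<alpha>"
  note car = normal_form_carrier
  have PK: "?P * K \<in> carrier_mat n n" and KQ: "K' * ?Q \<in> carrier_mat n n" using car by auto
  have "map_mat \<sigma> (K' * ?Q) * map_mat \<sigma> (?P * K) = \<sigma> (lam \<alpha>) \<cdot>\<^sub>m 1\<^sub>m n"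
    unfolding \<sigma>.mat_hom_mult[OF KQ PK, symmetric] normal_form_E_F
    by (rule eq_matI) auto
  moreover have "?P * K * map_mat \<sigma>_inv (map_mat \<sigma> (K' * ?Q)) = lam \<alpha> \<cdot>\<^sub>m 1\<^sub>m n"
    unfolding map_mat_\<sigma>_inverse by (rule normal_form_F_E)
  moreover have "\<sigma> (lam \<alpha>) \<cdot>\<^sub>m 1\<^sub>m n - lam \<alpha> \<cdot>\<^sub>m 1\<^sub>m n = [:0, 2:] \<cdot>\<^sub>m (1\<^sub>m n)"
    by (rule eq_matI) (auto simp: \<sigma>_lam)
  ultimately show ?thesis using PK KQ by (simp add: admissible_def)
qed

end

lemma smult_one_mat_mult_vec: "g \<in> carrier_vec n \<Longrightarrow> (p \<cdot>\<^sub>m 1\<^sub>m n) *\<^sub>v g = p \<cdot>\<^sub>v (g :: 'a :: comm_ring_1 vec)"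
  by (intro eq_vecI) auto

lemma eq_mat_on_vecI:
  fixes A B :: "'a :: comm_ring_1 mat"
  assumes "\<And>g. g \<in> carrier_vec n \<Longrightarrow> A *\<^sub>v g = B *\<^sub>v g"
    and "A \<in> carrier_mat m n" "B \<in> carrier_mat m n"
  shows "A = B"
proof (rule mat_col_eqI)
  fix j assume "j < dim_col B"
  with assms(3) have j: "j < n" by simp
  have "C *\<^sub>v unit_vec n j = col C j" if "C \<in> carrier_mat m n" for C :: "'a mat"
    using that j by (intro eq_vecI) auto
  with assms(1)[of "unit_vec n j"] assms(2,3) show "col A j = col B j" by simp
qed (use assms(2,3) in auto)

theorem theorem1p9:
  fixes M :: "'v sl2_rep" and n :: nat and \<alpha> :: complex
  assumes "n \<ge> 1"
    and "sl2_module M"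
    and "free_of_rank class_ring (Uh_module M) n"
    and "has_central_character M ((2 * \<alpha> - 1)\<^sup>2)"
  shows "\<exists>K \<in> Units (ring_mat TYPE(complex poly) n ()). \<exists>(am::nat) (a0::int) (ap::nat).
           int am + \<bar>a0\<bar> + int ap = int n \<and>
           (let E = map_mat \<sigma> (inv\<^bsub>ring_mat TYPE(complex poly) n ()\<^esub> K * Pbar_mat am a0 ap \<alpha>);
                F = P_mat am a0 ap \<alpha> * K
            in admissible n E F \<and> sl2_isomorphic M (M_EF n E F))"
proof -
  interpret sl2_mod M using assms(2) by unfold_locales
  obtain \<psi>0 where \<psi>0: "coordinates n \<psi>0"
    using coordinates_exist[OF assms(3)] .
  obtain E0 where E0: "E0 \<in> carrier_mat n n"
    and e0: "\<And>g. g \<in> carrier_vec n \<Longrightarrow> act M sl2_e (\<psi>0 g) = \<psi>0 (E0 *\<^sub>v map_vec \<sigma> g)"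
    using semilinear_matrix[OF \<psi>0, of "act M sl2_e" \<sigma>] act_e_poly_smult \<sigma>.comm_ring_hom_axioms
    by (metis act_hom(1,2) sl2_basis(1))
  obtain F0 where F0: "F0 \<in> carrier_mat n n"
    and f0: "\<And>g. g \<in> carrier_vec n \<Longrightarrow> act M sl2_f (\<psi>0 g) = \<psi>0 (F0 *\<^sub>v map_vec \<sigma>_inv g)"
    using semilinear_matrix[OF \<psi>0, of "act M sl2_f" \<sigma>_inv] act_f_poly_smult \<sigma>_inv.comm_ring_hom_axioms
    by (metis act_hom(1,2) sl2_basis(2))
  let ?Y = "map_mat \<sigma>_inv E0"
  have Y: "?Y \<in> carrier_mat n n" using E0 by simp
  \<comment> \<open>The action of fe is computed in two ways. The twist of f undoes that of e on the
    vector and falls on the entries of \<open>E0\<close> instead, so fe is given by an honest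
    matrix.\<close>
  have FY: "F0 * ?Y = lam \<alpha> \<cdot>\<^sub>m 1\<^sub>m n"
  proof (rule eq_mat_on_vecI)
    fix g :: "complex poly vec" assume g: "g \<in> carrier_vec n"
    have "\<psi>0 (lam \<alpha> \<cdot>\<^sub>v g) = act M sl2_f (act M sl2_e (\<psi>0 g))"
      using coordinatesD(1,3)[OF \<psi>0 g] act_f_e[OF assms(4)] by simp
    also have "\<dots> = \<psi>0 (F0 *\<^sub>v map_vec \<sigma>_inv (E0 *\<^sub>v map_vec \<sigma> g))"
      using g E0 by (simp add: e0 f0)
    also have "map_vec \<sigma>_inv (E0 *\<^sub>v map_vec \<sigma> g) = ?Y *\<^sub>v g"
      using \<sigma>_inv.mult_mat_vec_hom[OF E0, of "map_vec \<sigma> g"] g by (simp add: map_vec_\<sigma>_inverse)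
    also have "F0 *\<^sub>v (?Y *\<^sub>v g) = (F0 * ?Y) *\<^sub>v g"
      using assoc_mult_mat_vec[OF F0 Y g] by simp
    finally show "(F0 * ?Y) *\<^sub>v g = (lam \<alpha> \<cdot>\<^sub>m 1\<^sub>m n) *\<^sub>v g"
      using g F0 Y coordinatesD(4)[OF \<psi>0, of "lam \<alpha> \<cdot>\<^sub>v g"]
      by (metis mult_carrier_mat mult_mat_vec_carrier smult_carrier_vec smult_one_mat_mult_vec)
  qed (use F0 Y in auto)
  obtain U V am a0 ap where U: "U \<in> GL n" and V: "V \<in> GL n" and n: "am + nat \<bar>a0\<bar> + ap = n"
    and F0_eq: "F0 = U * P_mat am a0 ap \<alpha> * V"
    using factorization_through_P_mat[OF F0 Y FY] .
  let ?P = "P_mat am a0 ap \<alpha>" and ?Q = "Pbar_mat am a0 ap \<alpha>"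
  define K where "K = V * map_mat \<sigma>_inv U"
  have K: "K \<in> GL n" unfolding K_def using V \<sigma>_inv.map_mat_GL[OF U] by (rule GL_mult)
  let ?Ki = "inv\<^bsub>ring_mat TYPE(complex poly) n ()\<^esub> K"
  let ?E = "map_mat \<sigma> (?Ki * ?Q)" and ?F = "?P * K"
  note K_inverse = GL_carrier[OF K] GL_inv(1)[OF K, THEN GL_carrier] GL_inv(2,3)[OF K]
  note car = U[THEN GL_carrier] V[THEN GL_carrier] K[THEN GL_carrier] GL_inv(1)[OF K, THEN GL_carrier]
    P_mat_carrier[of am a0 ap \<alpha>, unfolded n] Pbar_mat_carrier[of am a0 ap \<alpha>, unfolded n]
  have E: "?E \<in> carrier_mat n n" and F: "?F \<in> carrier_mat n n" and KQ: "?Ki * ?Q \<in> carrier_mat n n"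
    using car by auto
  define \<psi> where "\<psi> g = \<psi>0 (U *\<^sub>v g)" for g
  have \<psi>: "coordinates n \<psi>"
    unfolding \<psi>_def using \<psi>0 U by (rule coordinates_change)
  note \<psi>D = coordinatesD[OF \<psi>]
  have f: "act M sl2_f (\<psi> g) = \<psi> (?F *\<^sub>v map_vec \<sigma>_inv g)" if g: "g \<in> carrier_vec n" for g
  proof -
    let ?g = "map_vec \<sigma>_inv g" and ?U = "map_mat \<sigma>_inv U"
    have Ug: "?U \<in> carrier_mat n n" "?g \<in> carrier_vec n" using car g by auto
    have "act M sl2_f (\<psi> g) = \<psi>0 (F0 *\<^sub>v map_vec \<sigma>_inv (U *\<^sub>v g))"
      using car g by (simp add: \<psi>_def f0)
    also have "map_vec \<sigma>_inv (U *\<^sub>v g) = ?U *\<^sub>v ?g"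
      using \<sigma>_inv.mult_mat_vec_hom[OF car(1) g] .
    \<comment> \<open>The leftmost U of the factorization is the one built into \<psi>; the twisted
      copy of U coming from the argument joins V to form K.\<close>
    also have "F0 *\<^sub>v (?U *\<^sub>v ?g) = U *\<^sub>v (?F *\<^sub>v ?g)"
      unfolding F0_eq K_def using car Ug by (simp add: assoc_mult_mat_vec[of _ n n _ n])
    finally show ?thesis by (simp add: \<psi>_def)
  qed
  \<comment> \<open>The action of f is injective because ?Ki * ?Q inverts ?F up to the nonzero factor lam.\<close>
  have f_inj: "g = g'"
    if g: "g \<in> carrier_vec n" "g' \<in> carrier_vec n" and eq: "act M sl2_f (\<psi> g) = act M sl2_f (\<psi> g')" for g g'
  proof -
    have "?F *\<^sub>v map_vec \<sigma>_inv g = ?F *\<^sub>v map_vec \<sigma>_inv g'"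
      using eq g F by (simp add: f \<psi>D(4))
    then have "(?Ki * ?Q) *\<^sub>v (?F *\<^sub>v map_vec \<sigma>_inv g) = (?Ki * ?Q) *\<^sub>v (?F *\<^sub>v map_vec \<sigma>_inv g')"
      by (rule arg_cong)
    then have "(?Ki * ?Q * ?F) *\<^sub>v map_vec \<sigma>_inv g = (?Ki * ?Q * ?F) *\<^sub>v map_vec \<sigma>_inv g'"
      using assoc_mult_mat_vec[OF KQ F] g by simp
    then have "lam \<alpha> \<cdot>\<^sub>v map_vec \<sigma>_inv g = lam \<alpha> \<cdot>\<^sub>v map_vec \<sigma>_inv g'"
      using normal_form_E_F[OF K_inverse n, of \<alpha>] g by (simp add: smult_one_mat_mult_vec)
    then have "map_vec \<sigma>_inv g = map_vec \<sigma>_inv g'"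
      using g lam_nonzero by (auto simp: vec_eq_iff)
    then show ?thesis by (metis map_vec_\<sigma>_inverse(1))
  qed
  have e: "act M sl2_e (\<psi> g) = \<psi> (?E *\<^sub>v map_vec \<sigma> g)" if g: "g \<in> carrier_vec n" for g
  proof -
    have Eg: "?E *\<^sub>v map_vec \<sigma> g \<in> carrier_vec n" using E g by auto
    \<comment> \<open>The two candidates for e are compared after applying f: both images are
      \<open>lam \<alpha>\<close> times the vector, and injectivity of f gives equality.\<close>
    have "act M sl2_f (\<psi> (?E *\<^sub>v map_vec \<sigma> g)) = \<psi> (?F *\<^sub>v map_vec \<sigma>_inv (?E *\<^sub>v map_vec \<sigma> g))"
      using Eg by (rule f)
    also have "map_vec \<sigma>_inv (?E *\<^sub>v map_vec \<sigma> g) = (?Ki * ?Q) *\<^sub>v g"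
      using \<sigma>_inv.mult_mat_vec_hom[OF E, of "map_vec \<sigma> g"] g by (simp add: map_vec_\<sigma>_inverse map_mat_\<sigma>_inverse)
    also have "?F *\<^sub>v ((?Ki * ?Q) *\<^sub>v g) = lam \<alpha> \<cdot>\<^sub>v g"
      using assoc_mult_mat_vec[OF F KQ g] normal_form_F_E[OF K_inverse n, of \<alpha>] g
      by (simp add: smult_one_mat_mult_vec)
    also have "\<psi> (lam \<alpha> \<cdot>\<^sub>v g) = act M sl2_f (act M sl2_e (\<psi> g))"
      using \<psi>D(1,3)[OF g] act_f_e[OF assms(4)] by simp
    finally have eq: "act M sl2_f (\<psi> (?E *\<^sub>v map_vec \<sigma> g)) = act M sl2_f (act M sl2_e (\<psi> g))" .
    obtain g' where g': "g' \<in> carrier_vec n" "\<psi> g' = act M sl2_e (\<psi> g)"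
      using coordinates_surj[OF \<psi> act_hom(1)[OF sl2_basis(1) \<psi>D(1)[OF g]]] .
    show ?thesis using f_inj[OF Eg g'(1)] eq g'(2) by simp
  qed
  have "admissible n ?E ?F"
    using normal_form_admissible[OF K_inverse n, of \<alpha>] .
  moreover have "sl2_isomorphic M (M_EF n ?E ?F)"
    using sl2_isomorphic_M_EF[OF \<psi> E F e f] .
  moreover have "int am + \<bar>a0\<bar> + int ap = int n" using n by linarith
  ultimately show ?thesis using K unfolding Let_def by blast
qed

end
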